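(* Let $r\ge1$, $V=\{0,1\}^r$, $k\in\{0,1,\dots,r\}$, and let $S\colon\mathbb R^V\to\mathbb R^V$ be the linear isomorphism $S(x)(\nu)=\sum_{\mu\in F(\nu)\cap V}(-1)^{\mu-\nu}x(\mu)$. Let $(u^{(n)})_{n\ge1}$ be a sequence in $(0,1)^r$ and $(x_n)_{n\ge1}$ a sequence in $\mathbb R^V$ such that $S(x_n)\in C_k(u^{(n)})$ for every $n\geq 1$ (a sequence of vertex copulas of order $k$). Then $c^\infty:=\operatorname{tnest}\bigl((S(x_n))_{n\ge1}\bigr)$ is a copula of order $k$ and satisfies, for all $n\ge1$ and all $\nu\in V$, $$\bigl(\pi^{F(\nu)}c^\infty\bigr)\bigl([0,d^{(n)}(\nu)]\bigr)=\prod_{l=1}^n x_l(\nu),$$ where $d^{(n)}_i(\nu)=(1-\nu_i)\prod_{l=1}^n u^{(l)}_i$ for $i=1,\dots,r$. Furthermore, if $d^{(n)}:=d^{(n)}(0,\dots,0)\to 0$ as $n\to\infty$, then $c^\infty$ is locally piecewise uniform on $[0,1]^r\setminus\bigcup\mathcal F_{>k}$, where $\mathcal F_{>k}$ is the set of front faces of $[0,1]^r$ of codimension $>k$.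
   Context: Faces. For $\nu\in V$, $F(\nu)=\{u\in[0,1]^r: u_i=0\text{ if }\nu_i=0\}$ is a front face, of dimension $\sum_i\nu_i$ and codimension $r-\sum_i\nu_i$. Put $\hat\nu=(1,\dots,1)-\nu$; the complementary front face of $F(\nu)$ is $F(\nu)^c=F(\hat\nu)$. For a front face $F$, $\pi^F\colon[0,1]^r\to F^c$ is the coordinate projection along $F$; the same symbol denotes push-forward of measures. $(-1)^{\mu-\nu}=\prod_i(-1)^{\mu_i-\nu_i}$. For $d\in[0,1]^r$, $[0,d]=\prod_i[0,d_i]$. Copulas of order $k$. A copula of order $k$ is a Borel probability measure on $[0,1]^r$ whose push-forward to each front face of dimension $k$ is the uniform probability measure. Vertex copulas. For $u\in(0,1)^r$ decompose $[0,1]^r$ into the $2^r$ boxes $J_\nu=\prod_iK_i$, $\nu\in V$, with $K_i=[0,u_i]$ if $\nu_i=0$ and $K_i=[u_i,1]$ if $\nu_i=1$. Via $u$, an element $z\in\mathbb R^V$ is identified with the signed measure on $[0,1]^r$ that is uniform (a multiple of Lebesgue measure) on each $J_\nu$ with mass $z(\nu)$ there. $C_k(u)$ is the set of $z\in[0,1]^V$ whose associated measure is a copula of order $k$. Tail nesting. A grid decomposition $\mathcal J$ of $[0,1]^r$ is a product of finite decompositions of $[0,1]$ (one per coordinate) into compact intervals of positive length with disjoint interiors; a grid copula is a copula whose restriction to each box of some grid $\mathcal J$ is uniform. For a box $J=\prod_iJ_i\in\mathcal J$ let $\nu_J\in V$ be given by $(\nu_J)_i=0$ if $0\in J_i$ and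 $(\nu_J)_i=1$ otherwise, and let $\imath_J\colon[0,1]^r\to J$ be the coordinatewise increasing affine bijection. For $z\in C_k(u)$ and $\nu\in V$ let $z^{(\nu)}=\pi^{F(\nu)}(z)\times\mathrm{cu}_{F(\nu)}$ be the product of the push-forward of $z$ to $F(\hat\nu)$ with the uniform probability measure on $F(\nu)$, a measure on $[0,1]^r=F(\hat\nu)\times F(\nu)$. For a grid copula $c$ of order $k$ with grid $\mathcal J$, $\operatorname{tnest}(z,c)$ is the measure obtained from $c$ by replacing, for each $J\in\mathcal J$, the restriction $c|_J$ by $c(J)\cdot(\imath_J)_*z^{(\nu_J)}$; its grid is obtained by subdividing each $J\in\mathcal J$ into the boxes $\imath_J(J_\nu)$, $\nu\in V$ (with $J_\nu$ the vertex boxes for $u$). Iteration. For $z_n\in C_k(u^{(n)})$, $n\ge1$, put $c^1=z_1$ (with its vertex grid) and $c^n=\operatorname{tnest}(z_n,c^{n-1})$ for $n\geq 2$. The copulas $c^n$ satisfy $c^m(J)=c^n(J)$ for every box $J$ of the grid of $c^n$ and $m\ge n$; $\operatorname{tnest}((z_n)_{n\ge1})=c^\infty$ denotes the limit measure, i.e. the weak limit of $(c^n)$ (which exists). Local piecewise uniformity. A box measure on $[0,1]^r$ is a signed measure which is a constant multiple of Lebesgue measure on each box of some decomposition of $[0,1]^r$ into finitely many compact boxes of positive side lengths with disjoint interiors. A probability measure $c$ is locally piecewise uniform on $E\subset[0,1]^r$ if each $w\in E$ has a neighbourhood $W$ in $[0,1]^r$ such that $c|_W$ is the restriction to $W$ of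 some box measure. *)

theory Defs
  imports "HOL-Probability.Probability"
begin

text \<open>The dimension r is the cardinality of the finite index type \<open>'r\<close>.  The vertex set
  V is the type \<open>bool ^ 'r\<close> (True for 1, False for 0), so that the space of real functions
  on V is \<open>bool ^ 'r \<Rightarrow> real\<close>.  A Borel probability measure on the unit cube is a
  Borel measure on \<open>real ^ 'r\<close> that gives the cube mass one.\<close>

type_synonym 'r vertex = "bool ^ 'r"

abbreviation unit_cube :: "(real ^ 'r::finite) set"
  where "unit_cube \<equiv> cbox 0 1"

definition vertex_point :: "'r::finite vertex \<Rightarrow> real ^ 'r"
  where "vertex_point \<nu> = (\<chi> i. of_bool (\<nu> $ i))"

definition front_face :: "'r::finite vertex \<Rightarrow> (real ^ 'r) set"
  where "front_face \<nu> = {p \<in> unit_cube. \<forall>i. \<not> \<nu> $ i \<longrightarrow> p $ i = 0}"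

definition face_dim :: "'r::finite vertex \<Rightarrow> nat"
  where "face_dim \<nu> = (\<Sum>i\<in>UNIV. of_bool (\<nu> $ i))"

definition face_codim :: "'r::finite vertex \<Rightarrow> nat"
  where "face_codim \<nu> = CARD('r) - face_dim \<nu>"

definition compl_vertex :: "'r::finite vertex \<Rightarrow> 'r vertex"
  where "compl_vertex \<nu> = (\<chi> i. \<not> \<nu> $ i)"

text \<open>The projection along \<open>front_face \<nu>\<close>, i.e. onto the complementary face
  \<open>front_face (compl_vertex \<nu>)\<close>.\<close>

definition proj_along :: "'r::finite vertex \<Rightarrow> real ^ 'r \<Rightarrow> real ^ 'r"
  where "proj_along \<nu> p = (\<chi> i. if \<nu> $ i then 0 else p $ i)"

definition push_along :: "'r::finite vertex \<Rightarrow> (real ^ 'r) measure \<Rightarrow> (real ^ 'r) measure"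
  where "push_along \<nu> M = distr M borel (proj_along \<nu>)"

text \<open>The uniform probability measure on \<open>front_face \<nu>\<close>, as a measure on the ambient space:
  uniform on [0,1] in the free coordinates, a point mass at 0 in the others.\<close>

definition uniform_face :: "'r::finite vertex \<Rightarrow> (real ^ 'r) measure"
  where "uniform_face \<nu> =
    distr (PiM UNIV (\<lambda>i. if \<nu> $ i then uniform_measure lborel {0..1} else return borel 0))
      borel (\<lambda>f. \<chi> i. f i)"

definition copula_of_order :: "nat \<Rightarrow> (real ^ 'r::finite) measure \<Rightarrow> bool"
  where "copula_of_order k M \<longleftrightarrow>
    prob_space M \<and> sets M = sets borel \<and> measure M unit_cube = 1 \<and>
    (\<forall>\<nu>. face_dim \<nu> = k \<longrightarrow> push_along (compl_vertex \<nu>) M = uniform_face \<nu>)"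

definition vertex_box :: "real ^ 'r::finite \<Rightarrow> 'r vertex \<Rightarrow> (real ^ 'r) set"
  where "vertex_box u \<nu> = {p. \<forall>i. p $ i \<in> (if \<nu> $ i then {u $ i..1} else {0..u $ i})}"

definition vertex_grid :: "real ^ 'r::finite \<Rightarrow> (real ^ 'r) set set"
  where "vertex_grid u = range (vertex_box u)"

text \<open>The measure identified with \<open>z\<close> via \<open>u\<close>.  It is only used for \<open>z \<ge> 0\<close>
  (\<open>ennreal\<close> would cut off negative values).  The boxes overlap in Lebesgue null sets only.\<close>

definition vertex_measure :: "real ^ 'r::finite \<Rightarrow> ('r vertex \<Rightarrow> real) \<Rightarrow> (real ^ 'r) measure"
  where "vertex_measure u z =
    density lborel (\<lambda>p. \<Sum>\<nu>\<in>UNIV.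
      ennreal (z \<nu> / measure lborel (vertex_box u \<nu>)) * indicator (vertex_box u \<nu>) p)"

definition vertex_copulas :: "nat \<Rightarrow> real ^ 'r::finite \<Rightarrow> ('r vertex \<Rightarrow> real) set"
  where "vertex_copulas k u =
    {z. (\<forall>\<nu>. z \<nu> \<in> {0..1}) \<and> copula_of_order k (vertex_measure u z)}"

definition S_map :: "('r::finite vertex \<Rightarrow> real) \<Rightarrow> 'r vertex \<Rightarrow> real"
  where "S_map x \<nu> =
    (\<Sum>\<mu> | vertex_point \<mu> \<in> front_face \<nu>.
      (\<Prod>i\<in>UNIV. (- 1) powi (of_bool (\<mu> $ i) - of_bool (\<nu> $ i))) * x \<mu>)"

text \<open>The product of \<open>push_along \<nu> M\<close> and \<open>uniform_face \<nu>\<close>.  The two complementary faces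
  are subsets of the same ambient space, and their product is identified with the cube
  by addition.\<close>

definition face_product :: "'r::finite vertex \<Rightarrow> (real ^ 'r) measure \<Rightarrow> (real ^ 'r) measure"
  where "face_product \<nu> M =
    distr (push_along \<nu> M \<Otimes>\<^sub>M uniform_face \<nu>) borel (\<lambda>(p, q). p + q)"

definition box_vertex :: "(real ^ 'r::finite) set \<Rightarrow> 'r vertex"
  where "box_vertex J = (\<chi> i. 0 \<notin> (\<lambda>p. p $ i) ` J)"

definition box_map :: "(real ^ 'r::finite) set \<Rightarrow> real ^ 'r \<Rightarrow> real ^ 'r"
  where "box_map J p =
    (\<chi> i. (1 - p $ i) * interval_lowerbound J $ i + p $ i * interval_upperbound J $ i)"

text \<open>Tail nesting of \<open>z\<close> (via \<open>u\<close>) into a copula \<open>c\<close> with grid \<open>G\<close>.  A grid is given by the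
  set of its boxes.  Since \<open>c\<close> is uniform on each box, box boundaries are null sets and the
  replacement of all restrictions to boxes is the sum of the new pieces.\<close>

definition tnest :: "real ^ 'r::finite \<Rightarrow> ('r vertex \<Rightarrow> real) \<Rightarrow> (real ^ 'r) set set \<Rightarrow>
    (real ^ 'r) measure \<Rightarrow> (real ^ 'r) measure"
  where "tnest u z G c =
    measure_of UNIV (sets borel) (\<lambda>A. \<Sum>J\<in>G. emeasure c J *
      emeasure (distr (face_product (box_vertex J) (vertex_measure u z)) borel (box_map J)) A)"

definition tnest_grid :: "real ^ 'r::finite \<Rightarrow> (real ^ 'r) set set \<Rightarrow> (real ^ 'r) set set"
  where "tnest_grid u G = (\<Union>J\<in>G. {box_map J ` vertex_box u \<nu> | \<nu>. True})"

text \<open>The sequences \<open>u\<close> and \<open>z\<close> are indexed from 1 (their values at 0 are irrelevant), so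
  stage \<open>n\<close> of the recursion is the (n+1)-st copula together with its grid.\<close>

primrec tnest_iter :: "(nat \<Rightarrow> real ^ 'r::finite) \<Rightarrow> (nat \<Rightarrow> 'r vertex \<Rightarrow> real) \<Rightarrow> nat \<Rightarrow>
    (real ^ 'r) measure \<times> (real ^ 'r) set set"
  where
    "tnest_iter u z 0 = (vertex_measure (u 1) (z 1), vertex_grid (u 1))"
  | "tnest_iter u z (Suc n) =
      (tnest (u (n + 2)) (z (n + 2)) (snd (tnest_iter u z n)) (fst (tnest_iter u z n)),
       tnest_grid (u (n + 2)) (snd (tnest_iter u z n)))"

text \<open>Weak convergence; \<open>weak_conv_m\<close> of the library is restricted to measures on the real
  line.\<close>

definition weak_limit :: "(nat \<Rightarrow> (real ^ 'r::finite) measure) \<Rightarrow> (real ^ 'r) measure \<Rightarrow> bool"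
  where "weak_limit N M \<longleftrightarrow>
    finite_measure M \<and> sets M = sets borel \<and>
    (\<forall>f :: real ^ 'r \<Rightarrow> real. continuous_on UNIV f \<longrightarrow> bounded (range f) \<longrightarrow>
      (\<lambda>n. \<integral>p. f p \<partial>(N n)) \<longlonglongrightarrow> (\<integral>p. f p \<partial>M))"

definition tnest_lim :: "(nat \<Rightarrow> real ^ 'r::finite) \<Rightarrow> (nat \<Rightarrow> 'r vertex \<Rightarrow> real) \<Rightarrow>
    (real ^ 'r) measure"
  where "tnest_lim u z = (THE M. weak_limit (\<lambda>n. fst (tnest_iter u z n)) M)"

definition tail_corner :: "(nat \<Rightarrow> real ^ 'r::finite) \<Rightarrow> nat \<Rightarrow> 'r vertex \<Rightarrow> real ^ 'r"
  where "tail_corner u n \<nu> = (\<chi> i. (1 - of_bool (\<nu> $ i)) * (\<Prod>l=1..n. u l $ i))"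

text \<open>Signed measures on the cube are real-valued functions on its Borel subsets.\<close>

definition signed_measure_on_cube :: "((real ^ 'r::finite) set \<Rightarrow> real) \<Rightarrow> bool"
  where "signed_measure_on_cube m \<longleftrightarrow>
    m {} = 0 \<and>
    (\<forall>A :: nat \<Rightarrow> (real ^ 'r) set.
      (\<forall>j. A j \<in> sets borel \<and> A j \<subseteq> unit_cube) \<longrightarrow> disjoint_family A \<longrightarrow>
      (\<lambda>j. m (A j)) sums m (\<Union>j. A j))"

definition box_measure :: "((real ^ 'r::finite) set \<Rightarrow> real) \<Rightarrow> bool"
  where "box_measure m \<longleftrightarrow>
    signed_measure_on_cube m \<and>
    (\<exists>D. D division_of unit_cube \<and> (\<forall>B\<in>D. interior B \<noteq> {}) \<and>
      (\<forall>B\<in>D. \<exists>a. \<forall>A\<in>sets borel. A \<subseteq> B \<longrightarrow> m A = a * measure lborel A))"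

definition locally_piecewise_uniform_on ::
    "(real ^ 'r::finite) measure \<Rightarrow> (real ^ 'r) set \<Rightarrow> bool"
  where "locally_piecewise_uniform_on c E \<longleftrightarrow>
    (\<forall>w\<in>E. \<exists>W m. openin (top_of_set unit_cube) W \<and> w \<in> W \<and> box_measure m \<and>
      (\<forall>A\<in>sets borel. A \<subseteq> W \<longrightarrow> measure c A = m A))"

definition faces_codim_gt :: "nat \<Rightarrow> (real ^ 'r::finite) set set"
  where "faces_codim_gt k = {front_face \<nu> | \<nu>. face_codim \<nu> > k}"

end

theory Submission imports Defs begin

text \<open>
  Write \<open>U_n,i\<close> for the product of \<open>u_1,i, ..., u_n,i\<close>.  Tail nesting has a description without
  grids: a point \<open>w\<close> distributed by \<open>c^n\<close> is refined by drawing an independent vertex \<open>\<nu>\<close> with law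
  \<open>z_(n+1)\<close> and by moving each coordinate with \<open>w_i < U_n,i\<close> affinely into \<open>[0, U_(n+1),i]\<close> if
  \<open>\<nu>_i = 0\<close> and into \<open>[U_(n+1),i, U_n,i]\<close> if \<open>\<nu>_i = 1\<close>; all other coordinates stay fixed.  Started
  from one uniform point and driven by an independent sequence of vertices this gives a coupling of
  all \<open>c^n\<close> that converges pointwise, so \<open>c^\<infinity>\<close> is the law of the pointwise limit.

  The corner \<open>[0, d^(n)(\<nu>)]\<close> is the event that the first \<open>n\<close> vertices all lie in \<open>F(\<nu>)\<close>; these events
  are independent and \<open>S\<close> inverts to \<open>x_l(\<nu>) = z_l(F(\<nu>))\<close>.  The order \<open>k\<close> of the vertex copulas
  means that any \<open>k\<close> coordinates of \<open>\<nu>\<close> are independent, so a step that effectively moves at most \<open>k\<close>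
  coordinates preserves a uniform distribution on a box.  This gives the uniform \<open>k\<close>-marginals, and
  it shows that \<open>c^\<infinity>\<close> agrees with \<open>c^N\<close> wherever all but at most \<open>k\<close> coordinates exceed \<open>U_N,i\<close>.
\<close>

section \<open>Borel measures and rectangles\<close>

text \<open>The obstacle is that tail nesting draws fresh samples in each grid box, which relates no
  points of successive copulas. Moving the old point has the same effect on laws because the law is
  uniform on every grid box. A side of a stage n box is either the cell from 0 to U_n,i, where an
  affine branch of a uniform coordinate is as good as a fresh coordinate of the vertex measure, or
  it lies beyond U_n,i, where a fresh uniform coordinate may be replaced by the one already there.
  This dichotomy is the value of (nu_J)_i. The coupling starts one step before c^1, with the uniform
  law and the cube as its only box, so that every c^n arises by the same step. Measures are compared
  on rectangles with arbitrary Borel sides: given the vertex and the box, everything factors over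
  the coordinates into one-dimensional uniform probabilities. The moving rule uses half-open cells,
  so that the bit of a moved coordinate can be read off from its new position; the discrepancies sit
  on null sets.\<close>

definition rect :: "('r::finite \<Rightarrow> real set) \<Rightarrow> (real ^ 'r) set"
  where "rect B = {p. \<forall>i. p $ i \<in> B i}"

lemma rect_iff [simp]: "p \<in> rect B \<longleftrightarrow> (\<forall>i. p $ i \<in> B i)"
  by (simp add: rect_def)

lemma rect_Int: "rect A \<inter> rect B = rect (\<lambda>i. A i \<inter> B i)"
  by auto

lemma cbox_eq_rect: "cbox a b = rect (\<lambda>i. {a $ i..b $ i})"
  by (auto simp: mem_box_cart)

lemma borel_measurable_vec_nth [measurable]:
  "(\<lambda>p :: real ^ 'r::finite. p $ i) \<in> borel_measurable borel"
  by (intro borel_measurable_continuous_onI continuous_intros)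

lemma borel_measurable_vec_lambda:
  assumes "\<And>i. (\<lambda>x. f x i) \<in> borel_measurable M"
  shows "(\<lambda>x. \<chi> i. (f x i :: real)) \<in> M \<rightarrow>\<^sub>M (borel :: (real ^ 'r::finite) measure)"
proof -
  have "(\<lambda>x. (\<chi> i. f x i) \<bullet> b) \<in> borel_measurable M" if "b \<in> Basis" for b :: "real ^ 'r"
  proof -
    from that obtain i where "b = axis i 1"
      by (auto simp: Basis_vec_def)
    then show ?thesis
      using assms by (simp add: inner_axis)
  qed
  then show ?thesis
    using borel_measurable_euclidean_space[of "\<lambda>x. \<chi> i. f x i" M] by blast
qed

lemma rect_borel [measurable]:
  assumes "\<And>i. B i \<in> sets borel"
  shows "rect B \<in> sets borel"
proof -
  have "rect B = (\<Inter>i. (\<lambda>p. p $ i) -` B i \<inter> space borel)"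
    by auto
  moreover have "(\<lambda>p. p $ i) -` B i \<inter> space borel \<in> sets borel" for i
    by (rule measurable_sets[OF borel_measurable_vec_nth assms])
  ultimately show ?thesis
    by auto
qed

lemma sets_borel_eq_sigma_rect:
  "sets (borel :: (real ^ 'r::finite) measure) = sigma_sets UNIV {rect B |B. \<forall>i. B i \<in> sets borel}"
proof
  have "box a b \<in> {rect B |B. \<forall>i. B i \<in> sets borel}" for a b :: "real ^ 'r"
    by (intro CollectI exI[of _ "\<lambda>i. {a $ i<..<b $ i}"]) (auto simp: mem_box_cart)
  then have "range (\<lambda>(a, b). box a b :: (real ^ 'r) set) \<subseteq> {rect B |B. \<forall>i. B i \<in> sets borel}"
    by auto
  then show "sets (borel :: (real ^ 'r) measure) \<subseteq> sigma_sets UNIV {rect B |B. \<forall>i. B i \<in> sets borel}"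
    unfolding borel_eq_box by (simp add: sigma_sets_mono')
  have "{rect B |B. \<forall>i. B i \<in> sets borel} \<subseteq> sets (borel :: (real ^ 'r) measure)"
    by auto
  from sets.sigma_sets_subset[OF this]
  show "sigma_sets UNIV {rect B |B. \<forall>i. B i \<in> sets borel} \<subseteq> sets (borel :: (real ^ 'r) measure)"
    by simp
qed

text \<open>Rectangles with Borel sides are stable under intersection, generate the Borel sets and
  include the whole space, so the uniqueness theorem for finite measures applies. This is the
  standard way of identifying two laws below.\<close>

lemma measure_eqI_rect:
  fixes M N :: "(real ^ 'r::finite) measure"
  assumes "finite_measure M" "finite_measure N" "sets M = sets borel" "sets N = sets borel"
    and eq: "\<And>B. (\<And>i. B i \<in> sets borel) \<Longrightarrow> measure M (rect B) = measure N (rect B)"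
  shows "M = N"
proof -
  interpret M: finite_measure M by fact
  interpret N: finite_measure N by fact
  show ?thesis
  proof (rule measure_eqI_generator_eq)
    show "Int_stable {rect B :: (real ^ 'r) set |B. \<forall>i. B i \<in> sets borel}"
      by (auto simp: Int_stable_def rect_Int) blast
    show "range (\<lambda>n::nat. UNIV) \<subseteq> {rect B :: (real ^ 'r) set |B. \<forall>i. B i \<in> sets borel}"
      by (auto intro!: exI[of _ "\<lambda>_. UNIV"])
  qed (use assms sets_borel_eq_sigma_rect in
      \<open>auto simp: M.emeasure_eq_measure N.emeasure_eq_measure\<close>)
qed

lemma vimage_vec_lambda_rect:
  "(\<lambda>f. \<chi> i. f i) -` rect B \<inter> space (PiM UNIV M) = (\<Pi>\<^sub>E i\<in>UNIV. B i \<inter> space (M i))"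
  by (auto simp: space_PiM PiE_def Pi_def)

lemma emeasure_distr_vec_lambda_rect:
  fixes M :: "'r::finite \<Rightarrow> real measure"
  assumes "\<And>i. sigma_finite_measure (M i)" "\<And>i. sets (M i) = sets borel"
    and B: "\<And>i. B i \<in> sets borel"
  shows "emeasure (distr (PiM UNIV M) borel (\<lambda>f. \<chi> i. f i)) (rect B) = (\<Prod>i\<in>UNIV. emeasure (M i) (B i))"
proof -
  interpret product_sigma_finite M
    using assms(1) by (rule product_sigma_finite.intro)
  have "(\<lambda>f. \<chi> i. f i) \<in> PiM UNIV M \<rightarrow>\<^sub>M borel"
  proof (intro borel_measurable_vec_lambda)
    show "(\<lambda>f. f i) \<in> borel_measurable (PiM UNIV M)" for i
      using measurable_component_singleton[of i UNIV M] assms(2)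
      by (simp add: measurable_def space_PiM PiE_def sets_eq_imp_space_eq[OF assms(2)])
  qed
  moreover have "B i \<inter> space (M i) = B i" for i
    using sets_eq_imp_space_eq[OF assms(2), of i] by simp
  ultimately show ?thesis
    using assms by (simp add: emeasure_distr vimage_vec_lambda_rect emeasure_PiM)
qed

section \<open>Lebesgue measure as a product measure\<close>

lemma prod_Basis_vec: "(\<Prod>b\<in>Basis. f (b :: real ^ 'r::finite)) = (\<Prod>i\<in>UNIV. f (axis i 1))"
proof -
  have Basis: "Basis = range (\<lambda>i. axis i (1::real) :: real ^ 'r)"
    by (auto simp: Basis_vec_def)
  have inj: "inj (\<lambda>i. axis i (1::real) :: real ^ 'r)"
    by (auto simp: inj_on_def axis_eq_axis)
  show ?thesis
    unfolding Basis prod.reindex[OF inj] by simp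
qed

text \<open>Lebesgue measure is characterised by the volumes of open boxes, and these are
  rectangles. The product form then gives the volume of every rectangle with Borel sides.\<close>

lemma lborel_eq_distr_vec_lambda:
  "lborel = distr (PiM UNIV (\<lambda>_::'r::finite. lborel :: real measure)) borel (\<lambda>f. \<chi> i. f i)"
proof (rule lborel_eqI)
  fix l u :: "real ^ 'r"
  assume le: "\<And>b. b \<in> Basis \<Longrightarrow> l \<bullet> b \<le> u \<bullet> b"
  have le': "l $ i \<le> u $ i" for i
    using le[of "axis i 1"] by (simp add: inner_axis)
  have "box l u = rect (\<lambda>i. {l $ i<..<u $ i})"
    by (auto simp: mem_box_cart)
  then show "emeasure (distr (PiM UNIV (\<lambda>_::'r. lborel :: real measure)) borel (\<lambda>f. \<chi> i. f i)) (box l u)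
      = (\<Prod>b\<in>Basis. (u - l) \<bullet> b)"
    using le' by (simp add: emeasure_distr_vec_lambda_rect lborel.sigma_finite_measure_axioms prod_Basis_vec
        inner_axis prod_ennreal)
qed simp

lemma emeasure_lborel_rect:
  assumes "\<And>i. B i \<in> sets borel"
  shows "emeasure lborel (rect B) = (\<Prod>i\<in>UNIV. emeasure lborel (B i))"
  by (subst lborel_eq_distr_vec_lambda, rule emeasure_distr_vec_lambda_rect)
    (simp_all add: assms lborel.sigma_finite_measure_axioms)

lemma enn2real_prod: "enn2real (\<Prod>i\<in>A. f i) = (\<Prod>i\<in>A. enn2real (f i))"
  by (induction A rule: infinite_finite_induct) (auto simp: enn2real_mult)

lemma measure_lborel_rect:
  assumes "\<And>i. B i \<in> sets borel"
  shows "measure lborel (rect B) = (\<Prod>i\<in>UNIV. measure lborel (B i))"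
  using assms by (simp add: measure_def emeasure_lborel_rect enn2real_prod)

section \<open>Uniform distributions on intervals and faces\<close>

abbreviation unif01 :: "real measure"
  where "unif01 \<equiv> uniform_measure lborel {0..1}"

lemma prob_space_unif01: "prob_space unif01"
  by (rule prob_space_uniform_measure) auto

lemma measure_unif01:
  assumes "B \<in> sets borel"
  shows "measure unif01 B = measure lborel (B \<inter> {0..1})"
  using assms by (subst measure_uniform_measure) (auto simp: Int_commute)

lemma emeasure_lborel_affine_vimage:
  fixes a c :: real
  assumes "c > 0" "B \<in> sets borel"
  shows "emeasure lborel ((\<lambda>x. a + c * x) -` B) * ennreal c = emeasure lborel B"
proof -
  have "emeasure lborel B = emeasure (density (distr lborel borel (\<lambda>x. a + c * x)) (\<lambda>_. ennreal \<bar>c\<bar>)) B"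
    using assms(1) lborel_real_affine[of c a] by simp
  also have "\<dots> = ennreal c * emeasure lborel ((\<lambda>x. a + c * x) -` B)"
    using assms by (simp add: emeasure_density emeasure_distr nn_integral_cmult_indicator)
  finally show ?thesis
    by (simp add: mult.commute)
qed

lemma measure_lborel_affine_vimage:
  fixes a c :: real
  assumes "c > 0" "B \<in> sets borel"
  shows "measure lborel ((\<lambda>x. a + c * x) -` B) = measure lborel B / c"
proof -
  have "measure lborel ((\<lambda>x. a + c * x) -` B) * c = measure lborel B"
    using emeasure_lborel_affine_vimage[OF assms, of a] assms(1)
    by (metis enn2real_ennreal enn2real_mult less_imp_le measure_def)
  then show ?thesis
    using assms(1) by (simp add: field_simps)
qed

text \<open>The map is the affine bijection of [0, 1] onto [a, b], so the uniform law is carried to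
  the uniform law on [a, b]. Since \<open>unif01\<close> ignores everything outside [0, 1], only the
  part of \<open>B\<close> in [a, b] counts.\<close>

lemma measure_unif01_affine_vimage:
  fixes a b :: real
  assumes "a < b" "B \<in> sets borel"
  shows "measure unif01 ((\<lambda>x. a + (b - a) * x) -` B) = measure lborel (B \<inter> {a..b}) / (b - a)"
proof -
  have eq: "(\<lambda>x. a + (b - a) * x) -` B \<inter> {0..1} = (\<lambda>x. a + (b - a) * x) -` (B \<inter> {a..b})"
  proof -
    have "0 \<le> x \<and> x \<le> 1 \<longleftrightarrow> a \<le> a + (b - a) * x \<and> a + (b - a) * x \<le> b" for x
    proof -
      have "(b - a) * x \<le> b - a \<longleftrightarrow> x \<le> 1" "0 \<le> (b - a) * x \<longleftrightarrow> 0 \<le> x"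
        using assms(1) mult_le_cancel_left_pos[of "b - a" x 1] by (simp_all add: zero_le_mult_iff)
      then show ?thesis
        by auto
    qed
    then show ?thesis
      by auto
  qed
  have "(\<lambda>x. a + (b - a) * x) -` B \<in> sets borel"
    using measurable_sets[of "\<lambda>x. a + (b - a) * x" borel borel B] assms(2) by simp
  then have "measure unif01 ((\<lambda>x. a + (b - a) * x) -` B) =
      measure lborel ((\<lambda>x. a + (b - a) * x) -` (B \<inter> {a..b}))"
    by (simp only: measure_unif01 eq)
  also have "\<dots> = measure lborel (B \<inter> {a..b}) / (b - a)"
    using assms by (intro measure_lborel_affine_vimage) auto
  finally show ?thesis .
qed

lemma uniform_face_factor:
  "prob_space (if b then unif01 else return borel 0)"
  "sets (if b then unif01 else return borel 0) = sets borel"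
  using prob_space_unif01 by (auto intro!: prob_space_return)

lemma uniform_face_prob_space: "prob_space (uniform_face \<nu>)"
  unfolding uniform_face_def
proof (rule prob_space.prob_space_distr)
  let ?M = "\<lambda>i. if \<nu> $ i then unif01 else return borel (0::real)"
  show "prob_space (PiM UNIV ?M)"
    by (intro prob_space_PiM uniform_face_factor)
  show "(\<lambda>f. \<chi> i. f i) \<in> PiM UNIV ?M \<rightarrow>\<^sub>M borel"
  proof (rule borel_measurable_vec_lambda)
    show "(\<lambda>f. f i) \<in> borel_measurable (PiM UNIV ?M)" for i
      by (rule measurable_compose[OF measurable_component_singleton]) (auto split: if_splits)
  qed
qed

lemma sets_uniform_face [simp, measurable_cong]: "sets (uniform_face \<nu>) = sets borel"
  by (simp add: uniform_face_def)

lemma space_uniform_face [simp]: "space (uniform_face \<nu>) = UNIV"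
  by (simp add: uniform_face_def)

lemma measure_uniform_face_rect:
  assumes "\<And>i. B i \<in> sets borel"
  shows "measure (uniform_face \<nu>) (rect B) =
    (\<Prod>i\<in>UNIV. if \<nu> $ i then measure unif01 (B i) else indicator (B i) 0)"
proof -
  let ?M = "\<lambda>i. if \<nu> $ i then unif01 else return borel (0::real)"
  have "emeasure (uniform_face \<nu>) (rect B) = (\<Prod>i\<in>UNIV. emeasure (?M i) (B i))"
    unfolding uniform_face_def using uniform_face_factor
    by (intro emeasure_distr_vec_lambda_rect prob_space_imp_sigma_finite) (simp_all add: assms)
  then have "measure (uniform_face \<nu>) (rect B) = (\<Prod>i\<in>UNIV. measure (?M i) (B i))"
    by (simp add: measure_def enn2real_prod)
  also have "\<dots> = (\<Prod>i\<in>UNIV. if \<nu> $ i then measure unif01 (B i) else indicator (B i) 0)"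
    using assms by (intro prod.cong) (auto simp: measure_return)
  finally show ?thesis .
qed

text \<open>For a nonempty closed set, the cut-offs of 1 minus n times the distance are bounded,
  continuous and converge to its indicator. Dominated convergence gives equality on closed sets,
  which are stable under intersection and generate the Borel sets.\<close>

lemma finite_measure_eqI_continuous:
  fixes M N :: "'a::{metric_space} measure"
  assumes "finite_measure M" "finite_measure N" and sets: "sets M = sets borel" "sets N = sets borel"
    and eq: "\<And>f :: 'a \<Rightarrow> real. continuous_on UNIV f \<Longrightarrow> bounded (range f) \<Longrightarrow>
      (\<integral>x. f x \<partial>M) = (\<integral>x. f x \<partial>N)"
  shows "M = N"
proof -
  interpret M: finite_measure M by fact
  interpret N: finite_measure N by fact
  note [measurable_cong] = sets
  have sp: "space M = UNIV" "space N = UNIV"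
    using sets_eq_imp_space_eq[OF sets(1)] sets_eq_imp_space_eq[OF sets(2)] by auto
  have closed: "measure M C = measure N C" if "closed C" for C
  proof (cases "C = {}")
    case False
    define f where "f n x = max 0 (1 - real n * infdist x C)" for n :: nat and x
    have cont: "continuous_on UNIV (f n)" for n
      unfolding f_def by (intro continuous_intros)
    have bd: "\<bar>f n x\<bar> \<le> 1" for n x
      by (auto simp: f_def infdist_nonneg)
    have C [measurable]: "C \<in> sets borel"
      using that by simp
    have f_measurable [measurable]: "f n \<in> borel_measurable borel" for n
      using cont by (rule borel_measurable_continuous_onI)
    have lim: "(\<lambda>n. f n x) \<longlonglongrightarrow> indicator C x" for x
    proof (cases "x \<in> C")
      case False
      then have pos: "infdist x C > 0"
        using in_closed_iff_infdist_zero[OF that \<open>C \<noteq> {}\<close>] infdist_nonneg[of x C]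
        by (metis less_eq_real_def)
      obtain n0 where n0: "1 / infdist x C \<le> real n0"
        using real_arch_simple by blast
      have "f n x = 0" if "n \<ge> n0" for n
      proof -
        have "1 / infdist x C \<le> real n"
          using n0 that by linarith
        then show ?thesis
          using pos by (simp add: f_def field_simps)
      qed
      then have "\<forall>\<^sub>F n in sequentially. f n x = 0"
        by (auto simp: eventually_sequentially)
      then show ?thesis
        using False by (simp add: tendsto_eventually)
    qed (simp add: f_def)
    have int: "(\<lambda>n. \<integral>x. f n x \<partial>K) \<longlonglongrightarrow> measure K C"
      if "finite_measure K" "sets K = sets borel" for K
    proof -
      interpret K: finite_measure K by fact
      note [measurable_cong] = that(2)
      have "(\<lambda>n. \<integral>x. f n x \<partial>K) \<longlonglongrightarrow> (\<integral>x. indicator C x \<partial>K)"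
        by (rule integral_dominated_convergence[where w = "\<lambda>_. 1"]) (use lim bd in auto)
      moreover have "C \<inter> space K = C"
        using sets_eq_imp_space_eq[OF that(2)] by simp
      ultimately show ?thesis
        by simp
    qed
    have "bounded (range (f n))" for n
      using bd by (auto simp: bounded_iff)
    then have "(\<integral>x. f n x \<partial>M) = (\<integral>x. f n x \<partial>N)" for n
      using eq cont by blast
    then show ?thesis
      using int[OF assms(1,3)] int[OF assms(2,4)] LIMSEQ_unique by fastforce
  qed simp
  show ?thesis
  proof (rule measure_eqI_generator_eq)
    show "Int_stable (Collect closed :: 'a set set)"
      by (auto simp: Int_stable_def)
    have "sets borel = sigma_sets UNIV (Collect closed :: 'a set set)"
    proof -
      have "sets (borel :: 'a measure) = sigma_sets UNIV (Collect open)"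
        unfolding borel_def by simp
      also have "\<dots> = sigma_sets UNIV (Collect closed)"
      proof (rule sigma_sets_eqI)
        show "a \<in> sigma_sets UNIV (Collect closed)" if "a \<in> Collect open" for a :: "'a set"
          using sigma_sets.Compl[of "- a" UNIV "Collect closed"] that
          by (auto simp: Compl_eq_Diff_UNIV[symmetric] closed_Compl)
        show "a \<in> sigma_sets UNIV (Collect open)" if "a \<in> Collect closed" for a :: "'a set"
          using sigma_sets.Compl[of "- a" UNIV "Collect open"] that
          by (auto simp: Compl_eq_Diff_UNIV[symmetric] open_Compl)
      qed
      finally show ?thesis .
    qed
    then show "sets M = sigma_sets UNIV (Collect closed)" "sets N = sigma_sets UNIV (Collect closed)"
      using sets by simp_all
    show "range (\<lambda>n::nat. UNIV) \<subseteq> (Collect closed :: 'a set set)"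
      by auto
  qed (use closed in \<open>auto simp: M.emeasure_eq_measure N.emeasure_eq_measure\<close>)
qed

text \<open>Gives the definite description in \<open>tnest_lim\<close> its uniqueness half.\<close>

lemma weak_limit_unique:
  assumes "weak_limit N M" "weak_limit N M'"
  shows "M = M'"
  using assms unfolding weak_limit_def
  by (intro finite_measure_eqI_continuous) (auto intro: LIMSEQ_unique)

section \<open>Vertex measures\<close>

text \<open>On [0, 1] this is the affine bijection onto the interval K_i of the vertex
  decomposition, here \<open>branch_ivl v b\<close>. A vertex measure is thus a mixture of images of
  the uniform law under products of such maps.\<close>

definition branch :: "real \<Rightarrow> bool \<Rightarrow> real \<Rightarrow> real"
  where "branch v b x = (if b then v + (1 - v) * x else v * x)"

definition branch_ivl :: "real \<Rightarrow> bool \<Rightarrow> real set"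
  where "branch_ivl v b = (if b then {v..1} else {0..v})"

lemma branch_measurable [measurable]: "branch v b \<in> borel_measurable borel"
  unfolding branch_def by (cases b) simp_all

lemma branch_ivl_borel [measurable]: "branch_ivl v b \<in> sets borel"
  by (simp add: branch_ivl_def)

lemma vimage_borel:
  assumes "f \<in> borel_measurable borel" "B \<in> sets borel"
  shows "f -` B \<in> sets borel"
  using measurable_sets[OF assms] by simp

lemma measure_branch_vimage:
  assumes v: "0 < v" "v < 1" and B: "B \<in> sets borel"
  shows "measure unif01 (branch v b -` B) =
    measure lborel (B \<inter> branch_ivl v b) / (if b then 1 - v else v)"
proof (cases b)
  case True
  then show ?thesis
    using measure_unif01_affine_vimage[of v 1 B] v B by (simp add: branch_def[abs_def] branch_ivl_def)
next
  case False
  then show ?thesis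
    using measure_unif01_affine_vimage[of 0 v B] v B by (simp add: branch_def[abs_def] branch_ivl_def)
qed

text \<open>Choosing a half with probability equal to its length and then a uniform point in it
  produces a uniform point of [0, 1]. This is the one-dimensional reason for all invariance
  statements.\<close>

lemma branch_mix:
  assumes v: "0 < v" "v < 1" and B: "B \<in> sets borel"
  shows "v * measure unif01 (branch v False -` B) + (1 - v) * measure unif01 (branch v True -` B) =
    measure unif01 B"
proof -
  have fm: "B \<inter> {a..b} \<in> fmeasurable lborel" for a b
    using B by (rule_tac fmeasurableI2[of "{a..b}"]) (simp_all add: fmeasurable_def emeasure_lborel_Icc_eq)
  have "B \<inter> {0..1} = (B \<inter> {0..v}) \<union> (B \<inter> {v..1})"
    using v by auto
  then have "measure lborel (B \<inter> {0..1}) = measure lborel (B \<inter> {0..v}) + measure lborel (B \<inter> {v..1} - B \<inter> {0..v})"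
    by (simp only: measure_Un2[OF fm fm])
  \<comment> \<open>The halves overlap at most in the point \<open>v\<close>, which is a null
    set.\<close>
  also have "measure lborel (B \<inter> {v..1} - B \<inter> {0..v}) = measure lborel (B \<inter> {v..1})"
  proof (intro measure_eq_AE)
    have "AE x in lborel. x \<noteq> v"
      by (rule AE_lborel_singleton)
    then show "AE x in lborel. x \<in> B \<inter> {v..1} - B \<inter> {0..v} \<longleftrightarrow> x \<in> B \<inter> {v..1}"
      by eventually_elim (use v in auto)
  qed (use B in auto)
  finally show ?thesis
    using assms by (simp add: measure_branch_vimage branch_ivl_def measure_unif01 Int_commute)
qed

lemma vertex_box_eq_rect: "vertex_box u \<nu> = rect (\<lambda>i. branch_ivl (u $ i) (\<nu> $ i))"
  by (simp add: vertex_box_def branch_ivl_def rect_def)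

lemma measure_vertex_box:
  assumes "u \<in> box 0 1"
  shows "measure lborel (vertex_box u \<nu>) = (\<Prod>i\<in>UNIV. if \<nu> $ i then 1 - u $ i else u $ i)"
  using assms unfolding vertex_box_eq_rect
  by (subst measure_lborel_rect) (auto simp: branch_ivl_def mem_box_cart less_imp_le intro!: prod.cong)

lemma sets_vertex_measure [simp, measurable_cong]: "sets (vertex_measure u z) = sets borel"
  by (simp add: vertex_measure_def)

lemma space_vertex_measure [simp]: "space (vertex_measure u z) = UNIV"
  by (simp add: vertex_measure_def)

text \<open>Rewrites the density as a mixture over vertices. The volume of a vertex box is the
  product of its side lengths, and each relative side measure is a uniform probability by
  \<open>measure_branch_vimage\<close>.\<close>

lemma measure_vertex_measure_rect:
  fixes u :: "real ^ 'r::finite"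
  assumes u: "u \<in> box 0 1" and z: "\<And>\<nu>. 0 \<le> z \<nu>" and B: "\<And>i. B i \<in> sets borel"
  shows "measure (vertex_measure u z) (rect B) =
    (\<Sum>\<nu>\<in>UNIV. z \<nu> * (\<Prod>i\<in>UNIV. measure unif01 (branch (u $ i) (\<nu> $ i) -` B i)))"
proof -
  have u': "0 < u $ i" "u $ i < 1" for i
    using u by (auto simp: mem_box_cart)
  have [measurable]: "rect B \<in> sets borel" "\<And>\<nu>. vertex_box u \<nu> \<in> sets borel"
    using B by (auto simp: vertex_box_eq_rect)
  \<comment> \<open>Vertex boxes lie in the cube, so their volumes are finite and the extended sum
    can be turned into a real one.\<close>
  have fin: "emeasure lborel (vertex_box u \<nu> \<inter> rect B) = ennreal (measure lborel (vertex_box u \<nu> \<inter> rect B))" for \<nu>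
  proof (rule emeasure_eq_ennreal_measure)
    have "vertex_box u \<nu> \<subseteq> unit_cube"
    proof
      fix p assume p: "p \<in> vertex_box u \<nu>"
      have "0 \<le> p $ i \<and> p $ i \<le> 1" for i
        using p u'[of i] by (auto simp: vertex_box_def dest!: spec[of _ i] split: if_splits)
      then show "p \<in> unit_cube"
        by (simp add: mem_box_cart)
    qed
    then have "emeasure lborel (vertex_box u \<nu> \<inter> rect B) \<le> emeasure lborel (unit_cube :: (real ^ 'r) set)"
      by (intro emeasure_mono) auto
    also have "\<dots> < \<infinity>"
      using emeasure_lborel_cbox_finite by blast
    finally show "emeasure lborel (vertex_box u \<nu> \<inter> rect B) \<noteq> top"
      by simp
  qed
  have q: "measure unif01 (branch (u $ i) (\<nu> $ i) -` B i) =
      measure lborel (branch_ivl (u $ i) (\<nu> $ i) \<inter> B i) / (if \<nu> $ i then 1 - u $ i else u $ i)" for \<nu> i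
    using measure_branch_vimage u' B by (simp add: Int_commute)
  have "emeasure (vertex_measure u z) (rect B) =
      (\<integral>\<^sup>+p. (\<Sum>\<nu>\<in>UNIV. ennreal (z \<nu> / measure lborel (vertex_box u \<nu>)) * indicator (vertex_box u \<nu> \<inter> rect B) p) \<partial>lborel)"
    unfolding vertex_measure_def
    by (subst emeasure_density) (simp_all only: sum_distrib_right mult.assoc indicator_inter_arith, measurable)
  also have "\<dots> = (\<Sum>\<nu>\<in>UNIV. ennreal (z \<nu> / measure lborel (vertex_box u \<nu>)) * emeasure lborel (vertex_box u \<nu> \<inter> rect B))"
    by (subst nn_integral_sum) (auto simp: nn_integral_cmult_indicator)
  also have "\<dots> = ennreal (\<Sum>\<nu>\<in>UNIV. z \<nu> / measure lborel (vertex_box u \<nu>) * measure lborel (vertex_box u \<nu> \<inter> rect B))"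
    unfolding fin using z
    by (subst sum_ennreal[symmetric]) (auto simp: ennreal_mult simp del: times_divide_eq_left intro!: sum.cong)
  finally have "measure (vertex_measure u z) (rect B) =
      (\<Sum>\<nu>\<in>UNIV. z \<nu> / measure lborel (vertex_box u \<nu>) * measure lborel (vertex_box u \<nu> \<inter> rect B))"
    using z by (intro measure_eq_emeasure_eq_ennreal sum_nonneg) auto
  also have "\<dots> = (\<Sum>\<nu>\<in>UNIV. z \<nu> * (\<Prod>i\<in>UNIV. measure unif01 (branch (u $ i) (\<nu> $ i) -` B i)))"
  proof (intro sum.cong refl)
    fix \<nu> :: "'r vertex"
    have "measure lborel (vertex_box u \<nu> \<inter> rect B) = (\<Prod>i\<in>UNIV. measure lborel (branch_ivl (u $ i) (\<nu> $ i) \<inter> B i))"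
      unfolding vertex_box_eq_rect rect_Int using B by (intro measure_lborel_rect) auto
    then show "z \<nu> / measure lborel (vertex_box u \<nu>) * measure lborel (vertex_box u \<nu> \<inter> rect B) =
        z \<nu> * (\<Prod>i\<in>UNIV. measure unif01 (branch (u $ i) (\<nu> $ i) -` B i))"
      by (simp add: measure_vertex_box[OF u] q prod_dividef)
  qed
  finally show ?thesis .
qed

section \<open>Projections and products with uniform face measures\<close>

lemma proj_along_measurable [measurable]: "proj_along \<nu> \<in> borel \<rightarrow>\<^sub>M borel"
  unfolding proj_along_def[abs_def] by (rule borel_measurable_vec_lambda) auto

lemma sets_push_along [simp, measurable_cong]: "sets (push_along \<nu> M) = sets borel"
  by (simp add: push_along_def)

lemma measure_push_along:
  assumes "sets M = sets borel" "A \<in> sets borel"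
  shows "measure (push_along \<nu> M) A = measure M (proj_along \<nu> -` A)"
proof -
  have "proj_along \<nu> \<in> M \<rightarrow>\<^sub>M borel"
    using assms(1) measurable_cong_sets[OF assms(1) refl] proj_along_measurable by blast
  then show ?thesis
    using assms sets_eq_imp_space_eq[OF assms(1)] by (simp add: push_along_def measure_distr)
qed

lemma prob_space_push_along:
  assumes "prob_space M" "sets M = sets borel"
  shows "prob_space (push_along \<nu> M)"
  unfolding push_along_def
  using assms by (intro prob_space.prob_space_distr) (simp_all add: measurable_cong_sets[OF assms(2) refl])

lemma proj_along_vimage_rect:
  "proj_along \<nu> -` rect B =
    rect (\<lambda>i. if \<nu> $ i then (if 0 \<in> B i then UNIV else {}) else B i)"
  by (auto simp: proj_along_def split: if_splits)

text \<open>The coordinates in \<open>\<nu>\<close> are discarded from \<open>M\<close> and replaced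
  by independent uniform ones. The two factors live on complementary faces, so adding them merely
  merges coordinates.\<close>

lemma measure_face_product_rect:
  fixes M :: "(real ^ 'r::finite) measure"
  assumes "prob_space M" and sets: "sets M = sets borel" and B: "\<And>i. B i \<in> sets borel"
  shows "measure (face_product \<nu> M) (rect B) =
    measure M (rect (\<lambda>i. if \<nu> $ i then UNIV else B i)) *
    (\<Prod>i\<in>UNIV. if \<nu> $ i then measure unif01 (B i) else 1)"
proof -
  let ?P = "push_along \<nu> M" and ?Q = "uniform_face \<nu>"
  interpret M: prob_space M by fact
  interpret P: prob_space ?P
    by (rule prob_space_push_along) fact+
  interpret Q: prob_space ?Q
    by (rule uniform_face_prob_space)
  interpret PQ: pair_prob_space ?P ?Q ..
  let ?f = "\<lambda>(p, q). p + q :: real ^ 'r"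
  let ?P1 = "rect (\<lambda>i. if \<nu> $ i then {0} else UNIV) :: (real ^ 'r) set"
  let ?Q1 = "rect (\<lambda>i. if \<nu> $ i then UNIV else {0}) :: (real ^ 'r) set"
  let ?P2 = "rect (\<lambda>i. if \<nu> $ i then {0} else B i)"
  let ?Q2 = "rect (\<lambda>i. if \<nu> $ i then B i else {0})"
  have rects [measurable]: "?P1 \<in> sets borel" "?Q1 \<in> sets borel" "?P2 \<in> sets borel" "?Q2 \<in> sets borel" "rect B \<in> sets borel"
    using B by (auto intro!: rect_borel)
  have "measure ?P ?P1 = 1"
  proof -
    have "proj_along \<nu> -` ?P1 = UNIV"
      by (auto simp: proj_along_def)
    then show ?thesis
      using M.prob_space sets_eq_imp_space_eq[OF sets] by (simp add: measure_push_along[OF sets])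
  qed
  then have P1: "AE p in ?P. p \<in> ?P1"
    by (subst P.AE_in_set_eq_1) auto
  have "measure ?Q ?Q1 = 1"
    by (subst measure_uniform_face_rect) (auto intro!: prod.neutral simp: measure_unif01)
  then have Q1: "AE q in ?Q. q \<in> ?Q1"
    by (subst Q.AE_in_set_eq_1) auto
  have "AE x in ?P \<Otimes>\<^sub>M ?Q. fst x \<in> ?P1" 
  proof (rule PQ.AE_pair_measure)
    show "{x \<in> space (?P \<Otimes>\<^sub>M ?Q). fst x \<in> ?P1} \<in> sets (?P \<Otimes>\<^sub>M ?Q)"
      using measurable_sets[OF measurable_fst[of ?P ?Q], of ?P1] rects(1)
      by (simp only: vimage_def Int_def mem_Collect_eq conj_commute sets_push_along)
  qed (use P1 in auto)
  moreover have "AE x in ?P \<Otimes>\<^sub>M ?Q. snd x \<in> ?Q1"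
  proof (rule PQ.AE_pair_measure)
    show "{x \<in> space (?P \<Otimes>\<^sub>M ?Q). snd x \<in> ?Q1} \<in> sets (?P \<Otimes>\<^sub>M ?Q)"
      using measurable_sets[OF measurable_snd[of ?P ?Q], of ?Q1] rects(2)
      by (simp only: vimage_def Int_def mem_Collect_eq conj_commute sets_uniform_face)
  qed (use Q1 in auto)
  \<comment> \<open>In each coordinate one summand is almost surely 0: \<open>p $ i\<close> if
    \<open>\<nu> $ i\<close>, and \<open>q $ i\<close> otherwise. Hence the event is a product set
    up to a null set.\<close>
  ultimately have AE: "AE x in ?P \<Otimes>\<^sub>M ?Q. x \<in> ?f -` rect B \<inter> space (?P \<Otimes>\<^sub>M ?Q) \<longleftrightarrow> x \<in> ?P2 \<times> ?Q2"
  proof eventually_elim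
    case (elim x)
    obtain p q where x: "x = (p, q)" by (cases x)
    have "p $ i + q $ i \<in> B i \<longleftrightarrow> p $ i \<in> (if \<nu> $ i then {0} else B i) \<and> q $ i \<in> (if \<nu> $ i then B i else {0})" for i
      using elim unfolding x by (auto dest!: spec[of _ i] split: if_splits)
    then show ?case
      by (auto simp: x space_pair_measure push_along_def)
  qed
  have "measure (face_product \<nu> M) (rect B) = measure (?P \<Otimes>\<^sub>M ?Q) (?f -` rect B \<inter> space (?P \<Otimes>\<^sub>M ?Q))"
    unfolding face_product_def by (subst measure_distr) auto
  also have "\<dots> = measure (?P \<Otimes>\<^sub>M ?Q) (?P2 \<times> ?Q2)"
  proof (rule PQ.finite_measure_eq_AE[OF AE])
    show "?f -` rect B \<inter> space (?P \<Otimes>\<^sub>M ?Q) \<in> sets (?P \<Otimes>\<^sub>M ?Q)"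
      by (rule measurable_sets[where A = borel]) auto
  qed auto
  also have "\<dots> = measure ?P ?P2 * measure ?Q ?Q2"
    by (simp add: measure_def Q.emeasure_pair_measure_Times enn2real_mult)
  also have "measure ?P ?P2 = measure M (rect (\<lambda>i. if \<nu> $ i then UNIV else B i))"
    by (subst measure_push_along[OF sets])
      (auto simp: proj_along_vimage_rect fun_eq_iff simp del: rect_iff intro!: arg_cong[where f = "\<lambda>B. measure M (rect B)"])
  also have "measure ?Q ?Q2 = (\<Prod>i\<in>UNIV. if \<nu> $ i then measure unif01 (B i) else 1)"
    using B by (subst measure_uniform_face_rect) (auto intro!: prod.cong)
  finally show ?thesis .
qed

lemma sets_face_product [simp, measurable_cong]: "sets (face_product \<nu> M) = sets borel"
  by (simp add: face_product_def)

lemma prob_space_face_product: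
  assumes "prob_space M" "sets M = sets borel"
  shows "prob_space (face_product \<nu> M)"
proof -
  interpret P: prob_space "push_along \<nu> M"
    by (rule prob_space_push_along) fact+
  interpret Q: prob_space "uniform_face \<nu>"
    by (rule uniform_face_prob_space)
  interpret PQ: pair_prob_space "push_along \<nu> M" "uniform_face \<nu>" ..
  show ?thesis
    unfolding face_product_def by (rule PQ.prob_space_distr) simp
qed

section \<open>Refinement of one coordinate\<close>

text \<open>One coordinate of a refinement step, where \<open>U\<close> is the end of the current
  cell at 0. On the half-open cell the new position is below \<open>v * U\<close> exactly if the bit
  is \<open>False\<close>; including \<open>U\<close> would spoil this equivalence.\<close>

definition coord_map :: "real \<Rightarrow> real \<Rightarrow> bool \<Rightarrow> real \<Rightarrow> real"
  where "coord_map U v b w = (if 0 \<le> w \<and> w < U then U * branch v b (w / U) else w)"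

lemma coord_map_measurable [measurable]: "coord_map U v b \<in> borel_measurable borel"
  unfolding coord_map_def by measurable

lemma coord_map_eq_self: "U \<le> w \<or> w < 0 \<Longrightarrow> coord_map U v b w = w"
  by (auto simp: coord_map_def)

lemma coord_map_scaled:
  assumes "0 \<le> t" "t < 1" "0 < U"
  shows "coord_map U v b (U * t) = U * branch v b t"
  using assms by (simp add: coord_map_def)

lemma branch_bounds:
  assumes "0 < v" "v < 1" "0 \<le> t" "t < 1"
  shows "0 \<le> branch v b t" "branch v b t < 1" "branch v b t < v \<longleftrightarrow> \<not> b"
proof -
  have *: "v * t < v" "(1 - v) * t < 1 - v" "0 \<le> v * t" "0 \<le> (1 - v) * t"
    using assms by simp_all
  show "0 \<le> branch v b t"
    using * assms(1) unfolding branch_def by (smt (verit))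
  show "branch v b t < 1"
    using * assms(2) unfolding branch_def by (smt (verit))
  show "branch v b t < v \<longleftrightarrow> \<not> b"
    using * unfolding branch_def by (smt (verit))
qed

lemma coord_map_bounds:
  assumes "0 < v" "v < 1" "0 \<le> w" "w < U"
  shows "0 \<le> coord_map U v b w" "coord_map U v b w < U" "coord_map U v b w < v * U \<longleftrightarrow> \<not> b"
proof -
  have *: "0 \<le> w / U" "w / U < 1" "0 < U"
    using assms by auto
  have "0 \<le> U * branch v b (w / U)" "U * branch v b (w / U) < U * 1"
    "U * branch v b (w / U) < U * v \<longleftrightarrow> \<not> b"
    using branch_bounds[OF assms(1,2) *(1,2), of b] *(3)
    by (simp_all only: mult_less_cancel_left_pos) simp_all
  then show "0 \<le> coord_map U v b w" "coord_map U v b w < U" "coord_map U v b w < v * U \<longleftrightarrow> \<not> b"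
    using assms by (auto simp: coord_map_def mult.commute)
qed

text \<open>Points of [0, U) stay there and all others are fixed, so no threshold \<open>c\<close>
  beyond \<open>U\<close> is ever crossed.\<close>

lemma coord_map_less_iff:
  assumes "0 < v" "v < 1" "U \<le> c"
  shows "0 \<le> coord_map U v b w \<and> coord_map U v b w < c \<longleftrightarrow> 0 \<le> w \<and> w < c"
  using assms coord_map_bounds[of v w U b] by (cases "0 \<le> w \<and> w < U") (auto simp: coord_map_eq_self)

lemma coord_map_greater_iff:
  assumes "0 < v" "v < 1" "0 \<le> U" "U \<le> c"
  shows "c < coord_map U v b w \<longleftrightarrow> c < w"
  using assms coord_map_bounds[of v w U b] by (cases "0 \<le> w \<and> w < U") (auto simp: coord_map_eq_self)

lemma coord_map_less_scaled_iff:
  assumes "0 < v" "v < 1" "0 < U"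
  shows "0 \<le> coord_map U v b w \<and> coord_map U v b w < v * U \<longleftrightarrow> 0 \<le> w \<and> w < U \<and> \<not> b"
proof (cases "0 \<le> w \<and> w < U")
  case False
  have "v * U < U"
    using assms by simp
  then show ?thesis
    using False by (auto simp: coord_map_eq_self)
qed (use coord_map_bounds[OF assms(1,2), of w U b] in auto)

lemma AE_unif01: "AE x in unif01. 0 \<le> x \<and> x < 1"
proof -
  have "AE x in lborel. x \<in> {0..1} \<longrightarrow> 0 \<le> x \<and> x < (1::real)"
    using AE_lborel_singleton[of "1::real"] by eventually_elim auto
  then show ?thesis
    by (subst AE_uniform_measure) (auto simp: emeasure_lborel_Icc_eq)
qed

lemma measure_unif01_cong:
  assumes "A \<in> sets borel" "B \<in> sets borel" "\<And>x. 0 \<le> x \<Longrightarrow> x < 1 \<Longrightarrow> x \<in> A \<longleftrightarrow> x \<in> B"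
  shows "measure unif01 A = measure unif01 B"
proof -
  interpret prob_space unif01
    by (rule prob_space_unif01)
  show ?thesis
    by (rule finite_measure_eq_AE) (use AE_unif01 assms in auto)
qed

definition cell :: "real \<Rightarrow> real \<Rightarrow> real \<Rightarrow> real"
  where "cell a b x = a + (b - a) * x"

lemma cell_measurable [measurable]: "cell a b \<in> borel_measurable borel"
  unfolding cell_def[abs_def] by simp

lemma measure_cell_vimage:
  assumes "a < b" "B \<in> sets borel"
  shows "measure unif01 (cell a b -` B) = measure lborel (B \<inter> {a..b}) / (b - a)"
  using measure_unif01_affine_vimage[OF assms] by (simp add: cell_def[abs_def])

lemma cell_ge:
  assumes "a < b" "0 \<le> x"
  shows "a \<le> cell a b x"
  using assms by (simp add: cell_def)

text \<open>The invariant of the sides of grid boxes at scale \<open>U\<close>: either the whole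
  cell at 0 or an interval beyond it. A refinement step therefore rescales a side completely or, up
  to an endpoint, leaves it alone.\<close>

definition grid_cell :: "real \<Rightarrow> real \<Rightarrow> real \<Rightarrow> bool"
  where "grid_cell U a b \<longleftrightarrow> 0 \<le> a \<and> a < b \<and> b \<le> 1 \<and> (a = 0 \<and> b = U \<or> U \<le> a)"

text \<open>Holds only up to the point 1 of [0, 1]: there \<open>coord_map\<close> fixes
  \<open>U\<close>, while \<open>branch v False\<close> ends at \<open>v\<close>.\<close>

lemma coord_map_cell_0:
  assumes "0 < U" "B \<in> sets borel"
  shows "measure unif01 (cell 0 U -` coord_map U v b -` B) = measure unif01 (branch v b -` cell 0 U -` B)"
  using assms by (intro measure_unif01_cong vimage_borel) (auto simp: cell_def coord_map_scaled)

lemma coord_map_cell_ge: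
  assumes "U \<le> a" "a < b" "B \<in> sets borel"
  shows "measure unif01 (cell a b -` coord_map U v c -` B) = measure unif01 (cell a b -` B)"
proof (intro measure_unif01_cong vimage_borel)
  fix x :: real assume "0 \<le> x" "x < 1"
  then have "coord_map U v c (cell a b x) = cell a b x"
    using cell_ge[of a b x] assms by (intro coord_map_eq_self) simp
  then show "x \<in> cell a b -` coord_map U v c -` B \<longleftrightarrow> x \<in> cell a b -` B"
    by simp
qed (use assms in auto)

text \<open>A random bit that is \<open>False\<close> with probability \<open>v\<close> preserves
  the uniform law on a cell: at 0 this is \<open>branch_mix\<close> after rescaling, beyond
  \<open>U\<close> nothing moves and the weights add up to 1.\<close>

lemma coord_map_mix:
  assumes "0 < U" "0 < v" "v < 1" "grid_cell U a b" "B \<in> sets borel"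
  shows "v * measure unif01 (cell a b -` coord_map U v False -` B) +
    (1 - v) * measure unif01 (cell a b -` coord_map U v True -` B) = measure unif01 (cell a b -` B)"
proof (cases "a = 0 \<and> b = U")
  case True
  have "cell 0 U -` B \<in> sets borel"
    using assms by (intro vimage_borel) auto
  then show ?thesis
    using True assms by (simp add: coord_map_cell_0 branch_mix)
next
  case False
  then have "U \<le> a" "a < b"
    using assms by (auto simp: grid_cell_def)
  then show ?thesis
    using assms(5) by (simp add: coord_map_cell_ge algebra_simps)
qed

section \<open>Inversion of S and independence of vertex coordinates\<close>

lemma sum_vertex_prod:
  fixes f :: "'r::finite \<Rightarrow> bool \<Rightarrow> 'a::comm_semiring_1"
  shows "(\<Sum>\<mu>\<in>UNIV. \<Prod>i\<in>UNIV. f i (\<mu> $ i)) = (\<Prod>i\<in>UNIV. f i False + f i True)"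
proof -
  have "(\<Sum>\<mu>\<in>UNIV. \<Prod>i\<in>UNIV. f i (\<mu> $ i)) = (\<Sum>g\<in>PiE UNIV (\<lambda>_. UNIV). \<Prod>i\<in>UNIV. f i (g i))"
    by (rule sum.reindex_bij_witness[of _ "\<lambda>g. \<chi> i. g i" "\<lambda>\<mu> i. \<mu> $ i"]) auto
  also have "\<dots> = (\<Prod>i\<in>UNIV. \<Sum>b\<in>UNIV. f i b)"
    by (rule prod_sum_PiE[symmetric]) auto
  finally show ?thesis
    by (simp add: UNIV_bool add.commute)
qed

lemma vertex_point_in_front_face: "vertex_point \<mu> \<in> front_face \<nu> \<longleftrightarrow> (\<forall>i. \<mu> $ i \<longrightarrow> \<nu> $ i)"
  by (auto simp: vertex_point_def front_face_def mem_box_cart of_bool_def)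

text \<open>Moebius inversion on the Boolean lattice: summing the alternating sums over all vertices
  below \<open>\<nu>\<close> leaves the single term at \<open>\<nu>\<close>. Everything is a product
  over coordinates, so the cancellation happens in one coordinate.\<close>

lemma sum_S_map:
  fixes x :: "'r::finite vertex \<Rightarrow> real"
  shows "(\<Sum>\<mu>\<in>UNIV. S_map x \<mu> * of_bool (\<forall>i. \<mu> $ i \<longrightarrow> \<nu> $ i)) = x \<nu>"
proof -
  define s :: "'r vertex \<Rightarrow> 'r \<Rightarrow> bool \<Rightarrow> real"
    where "s \<kappa> i b = of_bool (\<kappa> $ i \<longrightarrow> b) * (- 1) powi (of_bool (\<kappa> $ i) - of_bool b) * of_bool (b \<longrightarrow> \<nu> $ i)" for \<kappa> i b
  have of_bool_all: "of_bool (\<forall>i. P i) = (\<Prod>i\<in>UNIV. of_bool (P i) :: real)" for P :: "'r \<Rightarrow> bool"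
    by (cases "\<forall>i. P i") (auto simp: prod_zero_iff)
  have "S_map x \<mu> * of_bool (\<forall>i. \<mu> $ i \<longrightarrow> \<nu> $ i) = (\<Sum>\<kappa>\<in>UNIV. x \<kappa> * (\<Prod>i\<in>UNIV. s \<kappa> i (\<mu> $ i)))" for \<mu>
  proof -
    have "S_map x \<mu> = (\<Sum>\<kappa>\<in>UNIV. of_bool (\<forall>i. \<kappa> $ i \<longrightarrow> \<mu> $ i) *
        ((\<Prod>i\<in>UNIV. (- 1) powi (of_bool (\<kappa> $ i) - of_bool (\<mu> $ i))) * x \<kappa>))"
      unfolding S_map_def vertex_point_in_front_face
      by (intro sum.mono_neutral_cong_left) auto
    then show ?thesis
      by (simp add: s_def sum_distrib_left sum_distrib_right of_bool_all prod.distrib mult_ac)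
  qed
  then have "(\<Sum>\<mu>\<in>UNIV. S_map x \<mu> * of_bool (\<forall>i. \<mu> $ i \<longrightarrow> \<nu> $ i)) =
      (\<Sum>\<mu>\<in>UNIV. \<Sum>\<kappa>\<in>UNIV. x \<kappa> * (\<Prod>i\<in>UNIV. s \<kappa> i (\<mu> $ i)))"
    by simp
  also have "\<dots> = (\<Sum>\<kappa>\<in>UNIV. x \<kappa> * (\<Prod>i\<in>UNIV. s \<kappa> i False + s \<kappa> i True))"
    by (subst sum.swap) (simp only: sum_distrib_left[symmetric] sum_vertex_prod)
  also have "\<dots> = (\<Sum>\<kappa>\<in>UNIV. x \<kappa> * of_bool (\<kappa> = \<nu>))"
  proof (intro sum.cong refl arg_cong2[where f = "(*)"])
    fix \<kappa> :: "'r vertex"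
    \<comment> \<open>The only cancellation is for \<open>\<kappa> $ i\<close> false and
      \<open>\<nu> $ i\<close> true, where both bits are admissible and carry opposite
      signs.\<close>
    have "s \<kappa> i False + s \<kappa> i True = of_bool (\<kappa> $ i = \<nu> $ i)" for i
      by (cases "\<kappa> $ i"; cases "\<nu> $ i") (auto simp: s_def)
    then show "(\<Prod>i\<in>UNIV. s \<kappa> i False + s \<kappa> i True) = of_bool (\<kappa> = \<nu>)"
      by (simp add: vec_eq_iff of_bool_all)
  qed
  finally show ?thesis
    by simp
qed

text \<open>The projection along the complement of \<open>A\<close> keeps just the coordinates in
  \<open>A\<close>. The others become 0, which a side \<open>UNIV\<close> accepts.\<close>

lemma copula_marginal:
  fixes M :: "(real ^ 'r::finite) measure"
  assumes M: "copula_of_order k M" and A: "card A = k" and B: "\<And>i. B i \<in> sets borel"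
  shows "measure M (rect (\<lambda>i. if i \<in> A then B i else UNIV)) = (\<Prod>i\<in>A. measure unif01 (B i))"
proof -
  define \<nu> :: "'r vertex" where "\<nu> = (\<chi> i. i \<in> A)"
  let ?B = "\<lambda>i. if i \<in> A then B i else UNIV"
  have "face_dim \<nu> = k"
    using A by (simp add: face_dim_def \<nu>_def)
  then have eq: "push_along (compl_vertex \<nu>) M = uniform_face \<nu>" and sets: "sets M = sets borel"
    using M by (auto simp: copula_of_order_def)
  have "measure M (rect ?B) = measure (push_along (compl_vertex \<nu>) M) (rect ?B)"
    using B by (subst measure_push_along[OF sets rect_borel])
      (auto simp: proj_along_vimage_rect compl_vertex_def \<nu>_def fun_eq_iff simp del: rect_iff
        intro!: arg_cong[where f = "\<lambda>B. measure M (rect B)"])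
  also have "\<dots> = (\<Prod>i\<in>UNIV. if i \<in> A then measure unif01 (B i) else 1)"
    unfolding eq using B by (subst measure_uniform_face_rect) (auto simp: \<nu>_def intro!: prod.cong)
  finally show ?thesis
    by (simp add: prod.If_cases)
qed

lemma vertex_copula_sum:
  fixes z :: "'r::finite vertex \<Rightarrow> real"
  assumes u: "u \<in> box 0 1" and z: "z \<in> vertex_copulas k u"
  shows "(\<Sum>\<nu>\<in>UNIV. z \<nu>) = 1"
proof -
  have nn: "0 \<le> z \<nu>" for \<nu>
    using z by (auto simp: vertex_copulas_def)
  have prob: "prob_space (vertex_measure u z)"
    using z by (auto simp: vertex_copulas_def copula_of_order_def)
  have "rect (\<lambda>_. UNIV) = (UNIV :: (real ^ 'r) set)"
    by auto
  then have "measure (vertex_measure u z) (rect (\<lambda>_. UNIV)) = 1"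
    using prob_space.prob_space[OF prob] by simp
  moreover have "measure unif01 UNIV = 1"
    using prob_space.prob_space[OF prob_space_unif01] by simp
  ultimately show ?thesis
    using measure_vertex_measure_rect[OF u nn, of "\<lambda>_. UNIV"] by simp
qed

text \<open>Under the law \<open>z\<close>, up to \<open>k\<close> vertex coordinates are
  independent, and coordinate \<open>i\<close> is \<open>False\<close> with probability
  \<open>u $ i\<close>. It is stated for arbitrary weights because they will be probabilities of
  refined sides. The weights are realised by a rectangle, on which uniformity of the
  \<open>k\<close>-marginals is then tested.\<close>

lemma vertex_copula_marginal:
  fixes z :: "'r::finite vertex \<Rightarrow> real"
  assumes u: "u \<in> box 0 1" and z: "z \<in> vertex_copulas k u" and k: "k \<le> CARD('r)"
    and A: "card A \<le> k" and h: "\<And>i b. 0 \<le> h i b" "\<And>i b. h i b \<le> 1"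
  shows "(\<Sum>\<nu>\<in>UNIV. z \<nu> * (\<Prod>i\<in>A. h i (\<nu> $ i))) = (\<Prod>i\<in>A. u $ i * h i False + (1 - u $ i) * h i True)"
proof -
  have u': "0 < u $ i" "u $ i < 1" for i
    using u by (auto simp: mem_box_cart)
  \<comment> \<open>Order \<open>k\<close> speaks of faces of dimension exactly \<open>k\<close>, so
    \<open>A\<close> is enlarged to that size and the new coordinates get weight 1.\<close>
  obtain A' where A': "A \<subseteq> A'" "card A' = k"
    using exists_subset_between[OF A, of UNIV] k by auto
  have nn: "0 \<le> z \<nu>" for \<nu>
    using z by (auto simp: vertex_copulas_def)
  define h' where "h' i b = (if i \<in> A then h i b else 1)" for i b
  have h': "0 \<le> h' i b" "h' i b \<le> 1" for i b
    using h by (auto simp: h'_def)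
  define l where "l i = u $ i * h' i False" for i
  define r where "r i = (1 - u $ i) * h' i True" for i
  have *: "0 \<le> l i" "l i \<le> u $ i" "0 \<le> r i" "u $ i \<le> 1 - r i" for i
  proof -
    have "r i \<le> 1 - u $ i"
      using u'[of i] h' by (simp add: r_def mult_left_le)
    then show "u $ i \<le> 1 - r i"
      by simp
  qed (use u' h' in \<open>auto simp: l_def r_def less_imp_le mult_left_le\<close>)
  \<comment> \<open>a subset of [0, 1] with prescribed relative measures \<open>h' i False\<close> and \<open>h' i True\<close> in the
    two intervals cut out by \<open>u $ i\<close>\<close>
  define B where "B i = {0..<l i} \<union> {1 - r i<..1}" for i
  have B [measurable]: "B i \<in> sets borel" for i
    by (simp add: B_def)
  have B0: "measure unif01 (branch (u $ i) False -` B i) = h' i False" for i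
  proof -
    have "B i \<inter> {0..u $ i} = {0..<l i}"
      using *[of i] u'[of i] by (auto simp: B_def)
    then show ?thesis
      using u'[of i] *[of i] by (simp add: l_def r_def measure_branch_vimage branch_ivl_def)
  qed
  have B1: "measure unif01 (branch (u $ i) True -` B i) = h' i True" for i
  proof -
    have "B i \<inter> {u $ i..1} = {1 - r i<..1}"
      using *[of i] u'[of i] by (auto simp: B_def)
    then show ?thesis
      using u'[of i] *[of i] by (simp add: l_def r_def measure_branch_vimage branch_ivl_def)
  qed
  have Bb: "measure unif01 (branch (u $ i) b -` B i) = h' i b" for i b
    using B0 B1 by (cases b) auto
  have one: "measure unif01 UNIV = 1"
    using prob_space.prob_space[OF prob_space_unif01] by simp
  have prod_A': "(\<Prod>i\<in>A'. g i) = (\<Prod>i\<in>A. g i)" if "\<And>i. i \<notin> A \<Longrightarrow> g i = 1" for g :: "'r \<Rightarrow> real"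
    using A'(1) that by (intro prod.mono_neutral_right) auto
  have "(\<Sum>\<nu>\<in>UNIV. z \<nu> * (\<Prod>i\<in>A. h i (\<nu> $ i))) = (\<Sum>\<nu>\<in>UNIV. z \<nu> * (\<Prod>i\<in>A'. h' i (\<nu> $ i)))"
    by (subst prod_A') (auto simp: h'_def)
  also have "\<dots> = (\<Sum>\<nu>\<in>UNIV. z \<nu> * (\<Prod>i\<in>UNIV. measure unif01 (branch (u $ i) (\<nu> $ i) -` (if i \<in> A' then B i else UNIV))))"
  proof (intro sum.cong refl arg_cong2[where f = "(*)"])
    fix \<nu> :: "'r vertex"
    have "(\<Prod>i\<in>UNIV. measure unif01 (branch (u $ i) (\<nu> $ i) -` (if i \<in> A' then B i else UNIV))) =
        (\<Prod>i\<in>UNIV. if i \<in> A' then h' i (\<nu> $ i) else 1)"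
      by (intro prod.cong) (auto simp: Bb one)
    then show "(\<Prod>i\<in>A'. h' i (\<nu> $ i)) = (\<Prod>i\<in>UNIV. measure unif01 (branch (u $ i) (\<nu> $ i) -` (if i \<in> A' then B i else UNIV)))"
      by (simp add: prod.If_cases)
  qed
  also have "\<dots> = measure (vertex_measure u z) (rect (\<lambda>i. if i \<in> A' then B i else UNIV))"
    using measure_vertex_measure_rect[OF u nn] by simp
  also have "\<dots> = (\<Prod>i\<in>A'. measure unif01 (B i))"
    using z A' by (intro copula_marginal[where k = k]) (auto simp: vertex_copulas_def)
  also have "\<dots> = (\<Prod>i\<in>A'. u $ i * h' i False + (1 - u $ i) * h' i True)"
    using branch_mix u' B by (intro prod.cong) (simp_all flip: B0 B1)
  also have "\<dots> = (\<Prod>i\<in>A. u $ i * h i False + (1 - u $ i) * h i True)"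
    by (subst prod_A') (auto simp: h'_def)
  finally show ?thesis .
qed

section \<open>Grids and uniform measures\<close>

text \<open>Has the form that \<open>box_measure\<close> asks for on each box of a
  decomposition.\<close>

definition uniform_on :: "(real ^ 'r::finite) measure \<Rightarrow> (real ^ 'r) set \<Rightarrow> bool"
  where "uniform_on M J \<longleftrightarrow> (\<exists>c. \<forall>A\<in>sets borel. A \<subseteq> J \<longrightarrow> measure M A = c * measure lborel A)"

text \<open>Restricting both \<open>M\<close> and the multiple of Lebesgue measure to the box makes
  them finite measures on the whole space, so that comparison on rectangles suffices.\<close>

lemma uniform_onI_rect:
  fixes M :: "(real ^ 'r::finite) measure"
  assumes "finite_measure M" and sets: "sets M = sets borel" and ab: "\<And>i. a $ i < b $ i"
    and rect: "\<And>B. (\<And>i. B i \<in> sets borel) \<Longrightarrow> (\<And>i. B i \<subseteq> {a $ i..b $ i}) \<Longrightarrow>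
      measure M (rect B) = c * (\<Prod>i\<in>UNIV. measure lborel (B i))"
  shows "uniform_on M (cbox a b)"
proof -
  interpret M: finite_measure M by fact
  note [measurable_cong] = sets
  let ?J = "cbox a b"
  \<comment> \<open>The mass of the box is \<open>c\<close> times a positive volume, so
    \<open>c\<close> is nonnegative and \<open>ennreal c\<close> below loses nothing.\<close>
  have "0 \<le> measure M (rect (\<lambda>i. {a $ i..b $ i}))"
    by simp
  also have "\<dots> = c * (\<Prod>i\<in>UNIV. b $ i - a $ i)"
    using ab by (subst rect) (auto simp: less_imp_le intro!: prod.cong)
  finally have c: "0 \<le> c"
    using ab by (simp add: zero_le_mult_iff prod_pos not_le[symmetric])
      (smt (verit) prod_pos)
  define M1 where "M1 = density M (indicator ?J)"
  define N1 where "N1 = density lborel (\<lambda>p. ennreal c * indicator ?J p)"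
  have M1: "emeasure M1 A = ennreal (measure M (A \<inter> ?J))" if "A \<in> sets borel" for A
    using that unfolding M1_def
    by (subst emeasure_density)
      (auto simp: sets M.emeasure_eq_measure indicator_inter_arith[symmetric] Int_commute)
  have fin: "emeasure lborel (A \<inter> ?J) = ennreal (measure lborel (A \<inter> ?J))" if "A \<in> sets borel" for A
  proof (rule emeasure_eq_ennreal_measure)
    have "emeasure lborel (A \<inter> ?J) \<le> emeasure lborel ?J"
      by (intro emeasure_mono) auto
    also have "\<dots> < \<infinity>"
      by (rule emeasure_lborel_cbox_finite)
    finally show "emeasure lborel (A \<inter> ?J) \<noteq> top"
      by simp
  qed
  have N1: "emeasure N1 A = ennreal (c * measure lborel (A \<inter> ?J))" if "A \<in> sets borel" for A
  proof -
    have "emeasure N1 A = (\<integral>\<^sup>+p. ennreal c * indicator (A \<inter> ?J) p \<partial>lborel)"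
      using that unfolding N1_def
      by (subst emeasure_density) (auto simp: indicator_inter_arith mult_ac)
    also have "\<dots> = ennreal c * emeasure lborel (A \<inter> ?J)"
      using that by (simp add: nn_integral_cmult_indicator)
    finally show ?thesis
      using fin[OF that] c by (simp add: ennreal_mult)
  qed
  have "M1 = N1"
  proof (rule measure_eqI_rect)
    show "sets M1 = sets borel" "sets N1 = sets borel"
      by (simp_all add: M1_def N1_def sets)
    show "finite_measure M1" "finite_measure N1"
      using M1[of UNIV] N1[of UNIV]
      by (auto intro!: finite_measureI simp: M1_def N1_def sets_eq_imp_space_eq[OF sets])
    fix B :: "'r \<Rightarrow> real set" assume B: "\<And>i. B i \<in> sets borel"
    have "rect B \<inter> ?J = rect (\<lambda>i. B i \<inter> {a $ i..b $ i})"
      by (simp add: cbox_eq_rect rect_Int)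
    then have "measure M (rect B \<inter> ?J) = c * measure lborel (rect B \<inter> ?J)"
      using B by (simp add: rect measure_lborel_rect)
    then show "measure M1 (rect B) = measure N1 (rect B)"
      using B by (simp add: measure_def M1 N1)
  qed
  have "measure M A = c * measure lborel A" if "A \<in> sets borel" "A \<subseteq> ?J" for A
  proof -
    have "ennreal (measure M (A \<inter> ?J)) = ennreal (c * measure lborel (A \<inter> ?J))"
      using M1[OF that(1)] N1[OF that(1)] \<open>M1 = N1\<close> by simp
    moreover have "A \<inter> ?J = A"
      using that by auto
    ultimately show ?thesis
      using c by simp
  qed
  then show ?thesis
    by (auto simp: uniform_on_def)
qed

text \<open>Distinct boxes of a division share only a Lebesgue null set. Constant density on one of
  them makes it \<open>M\<close>-null as well, so the overlapping pieces may be summed.\<close>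

lemma uniform_on_division_sum:
  fixes M :: "(real ^ 'r::finite) measure"
  assumes "prob_space M" and sets: "sets M = sets borel" and cube: "measure M unit_cube = 1"
    and G: "G division_of unit_cube" and unif: "\<And>J. J \<in> G \<Longrightarrow> uniform_on M J"
    and A: "A \<in> sets borel"
  shows "measure M A = (\<Sum>J\<in>G. measure M (A \<inter> J))"
proof -
  interpret M: prob_space M by fact
  note [measurable_cong] = sets
  have J: "J \<in> sets borel" if "J \<in> G" for J
    using division_ofD(4)[OF G that] by auto
  have null: "AE p in M. p \<notin> J \<or> p \<notin> K" if JK: "J \<in> G" "K \<in> G" "J \<noteq> K" for J K
  proof -
    obtain a b c d where ab: "J = cbox a b" "K = cbox c d"
      using division_ofD(4)[OF G] JK by metis
    have "interior (J \<inter> K) = {}"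
      using division_ofD(5)[OF G] JK by (simp add: interior_Int)
    then have "measure lborel (J \<inter> K) = 0"
      unfolding ab Int_interval content_eq_0_interior .
    moreover obtain e where "\<forall>A\<in>sets borel. A \<subseteq> J \<longrightarrow> measure M A = e * measure lborel A"
      using unif[OF JK(1)] by (auto simp: uniform_on_def)
    ultimately have "measure M (J \<inter> K) = 0"
      using J JK by auto
    then have "AE p in M. p \<notin> J \<inter> K"
      using J JK by (subst AE_iff_measurable[where N = "J \<inter> K"])
        (auto simp: M.emeasure_eq_measure sets sets_eq_imp_space_eq[OF sets])
    then show ?thesis
      by eventually_elim auto
  qed
  have "AE p in M. p \<in> unit_cube"
    using cube by (subst M.AE_in_set_eq_1) (auto simp: sets)
  then have "measure M A = measure M (\<Union>J\<in>G. A \<inter> J)"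
    using division_ofD(6)[OF G] A J division_ofD(1)[OF G]
    by (intro M.finite_measure_eq_AE) (auto simp: sets elim!: eventually_mono)
  also have "\<dots> = (\<Sum>J\<in>G. measure M (A \<inter> J))"
  proof (rule measure_UNION_AE)
    show "pairwise (\<lambda>J K. AE p in M. p \<notin> A \<inter> J \<or> p \<notin> A \<inter> K) G"
      unfolding pairwise_def
    proof (intro ballI impI)
      fix J K assume "J \<in> G" "K \<in> G" "J \<noteq> K"
      then show "AE p in M. p \<notin> A \<inter> J \<or> p \<notin> A \<inter> K"
        using null[of J K] by (auto elim: eventually_mono)
    qed
  qed (use division_ofD(1)[OF G] A J in \<open>auto simp: sets fmeasurable_def M.emeasure_eq_measure\<close>)
  finally show ?thesis .
qed

text \<open>\<open>measure_of\<close> returns the given set function only if that is countably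
  additive, so this has to be verified before \<open>tnest\<close> can be evaluated.\<close>

lemma emeasure_tnest:
  fixes c :: "(real ^ 'r::finite) measure"
  assumes "finite G" "A \<in> sets borel"
  shows "emeasure (tnest u z G c) A = (\<Sum>J\<in>G. emeasure c J *
      emeasure (distr (face_product (box_vertex J) (vertex_measure u z)) borel (box_map J)) A)"
  unfolding tnest_def
proof (rule emeasure_measure_of_sigma)
  let ?N = "\<lambda>J. distr (face_product (box_vertex J) (vertex_measure u z)) borel (box_map J)"
  show "sigma_algebra UNIV (sets (borel :: (real ^ 'r) measure))"
    using sets.sigma_algebra_axioms[of "borel :: (real ^ 'r) measure"] by simp
  show "positive (sets borel) (\<lambda>A. \<Sum>J\<in>G. emeasure c J * emeasure (?N J) A)"
    by (simp add: positive_def)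
  show "countably_additive (sets borel) (\<lambda>A. \<Sum>J\<in>G. emeasure c J * emeasure (?N J) A)"
  proof (rule countably_additiveI)
    fix A :: "nat \<Rightarrow> (real ^ 'r) set"
    assume A: "range A \<subseteq> sets borel" "disjoint_family A"
    have "(\<Sum>i. \<Sum>J\<in>G. emeasure c J * emeasure (?N J) (A i)) =
        (\<Sum>J\<in>G. \<Sum>i. emeasure c J * emeasure (?N J) (A i))"
      by (rule suminf_sum) simp
    also have "\<dots> = (\<Sum>J\<in>G. emeasure c J * emeasure (?N J) (\<Union>i. A i))"
      using A by (simp add: suminf_emeasure)
    finally show "(\<Sum>i. \<Sum>J\<in>G. emeasure c J * emeasure (?N J) (A i)) =
        (\<Sum>J\<in>G. emeasure c J * emeasure (?N J) (\<Union>i. A i))" .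
  qed
qed fact

lemma sets_tnest [simp]: "sets (tnest u z G c) = sets borel"
proof -
  have "sets (tnest u z G c) = sigma_sets UNIV (sets borel)"
    unfolding tnest_def by (rule sets_measure_of) simp
  then show ?thesis
    using sets.sigma_sets_eq[of "borel :: (real ^ 'r) measure"] by simp
qed

section \<open>Subdivision of grid boxes\<close>

lemma box_map_measurable [measurable]: "box_map J \<in> borel \<rightarrow>\<^sub>M borel"
  unfolding box_map_def[abs_def] by (rule borel_measurable_vec_lambda) measurable

lemma box_map_cbox:
  assumes "\<And>i. a $ i \<le> b $ i"
  shows "box_map (cbox a b) p = (\<chi> i. cell (a $ i) (b $ i) (p $ i))"
proof -
  have "\<And>i. i \<in> Basis \<Longrightarrow> a \<bullet> i \<le> b \<bullet> i"
    using assms by (auto simp: Basis_vec_def inner_axis)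
  then show ?thesis
    by (simp add: box_map_def cell_def algebra_simps vec_eq_iff)
qed

lemma box_vertex_cbox:
  assumes "\<And>i. a $ i \<le> b $ i" "\<And>i. 0 \<le> a $ i"
  shows "box_vertex (cbox a b) $ i \<longleftrightarrow> a $ i \<noteq> 0"
proof -
  have "0 \<in> (\<lambda>p. p $ i) ` cbox a b \<longleftrightarrow> a $ i = 0"
  proof
    assume "0 \<in> (\<lambda>p. p $ i) ` cbox a b"
    then show "a $ i = 0"
      using assms(2)[of i] by (auto simp: mem_box_cart dest!: spec[of _ i])
  next
    assume "a $ i = 0"
    then show "0 \<in> (\<lambda>p. p $ i) ` cbox a b"
      using assms(1) by (intro image_eqI[of _ _ a]) (auto simp: mem_box_cart)
  qed
  then show ?thesis
    by (simp add: box_vertex_def)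
qed

text \<open>With \<open>child_upper\<close>, the corners of the box that vertex \<open>\<nu>\<close>
  cuts out of \<open>cbox a b\<close>, as \<open>box_map_vertex_box\<close> shows.\<close>

definition child_lower :: "real ^ 'r \<Rightarrow> real ^ 'r \<Rightarrow> real ^ 'r \<Rightarrow> 'r::finite vertex \<Rightarrow> real ^ 'r"
  where "child_lower v a b \<nu> = (\<chi> i. cell (a $ i) (b $ i) (if \<nu> $ i then v $ i else 0))"

definition child_upper :: "real ^ 'r \<Rightarrow> real ^ 'r \<Rightarrow> real ^ 'r \<Rightarrow> 'r::finite vertex \<Rightarrow> real ^ 'r"
  where "child_upper v a b \<nu> = (\<chi> i. cell (a $ i) (b $ i) (if \<nu> $ i then 1 else v $ i))"

lemma cell_image:
  assumes "a < b"
  shows "cell a b ` {l..h} = {cell a b l..cell a b h}"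
proof -
  have "y \<in> cell a b ` {l..h}" if "cell a b l \<le> y" "y \<le> cell a b h" for y
  proof
    show "y = cell a b ((y - a) / (b - a))"
      using assms by (simp add: cell_def)
    show "(y - a) / (b - a) \<in> {l..h}"
      using assms that by (simp add: cell_def field_simps)
  qed
  then show ?thesis
    using assms by (auto simp: cell_def mult_left_mono)
qed

lemma box_map_vertex_box:
  fixes a b v :: "real ^ 'r::finite"
  assumes "\<And>i. a $ i < b $ i"
  shows "box_map (cbox a b) ` vertex_box v \<nu> = cbox (child_lower v a b \<nu>) (child_upper v a b \<nu>)"
proof -
  let ?l = "\<lambda>i. if \<nu> $ i then v $ i else 0" and ?h = "\<lambda>i. if \<nu> $ i then 1 else v $ i"
  have vb: "vertex_box v \<nu> = rect (\<lambda>i. {?l i..?h i})"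
    by (auto simp: vertex_box_def split: if_splits)
  have eq: "box_map (cbox a b) p = (\<chi> i. cell (a $ i) (b $ i) (p $ i))" for p
    using assms by (intro box_map_cbox) (simp add: less_imp_le)
  have im: "cell (a $ i) (b $ i) ` {?l i..?h i} = {child_lower v a b \<nu> $ i..child_upper v a b \<nu> $ i}" for i
    using assms by (subst cell_image) (auto simp: child_lower_def child_upper_def)
  show ?thesis
  proof (intro set_eqI iffI)
    fix y assume "y \<in> box_map (cbox a b) ` vertex_box v \<nu>"
    then obtain p where "p \<in> rect (\<lambda>i. {?l i..?h i})" "y = (\<chi> i. cell (a $ i) (b $ i) (p $ i))"
      unfolding vb eq by blast
    then have "\<And>i. p $ i \<in> {?l i..?h i}" "\<And>i. y $ i = cell (a $ i) (b $ i) (p $ i)"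
      by auto
    then show "y \<in> cbox (child_lower v a b \<nu>) (child_upper v a b \<nu>)"
      unfolding cbox_eq_rect rect_iff im[symmetric] by blast
  next
    fix y assume "y \<in> cbox (child_lower v a b \<nu>) (child_upper v a b \<nu>)"
    then have "\<forall>i. \<exists>x. x \<in> {?l i..?h i} \<and> y $ i = cell (a $ i) (b $ i) x"
      unfolding cbox_eq_rect rect_iff im[symmetric] by blast
    then obtain x where "\<And>i. x i \<in> {?l i..?h i}" "\<And>i. y $ i = cell (a $ i) (b $ i) (x i)"
      by metis
    then have "y = box_map (cbox a b) (\<chi> i. x i)" "(\<chi> i. x i) \<in> vertex_box v \<nu>"
      unfolding vb eq by (auto simp: vec_eq_iff)
    then show "y \<in> box_map (cbox a b) ` vertex_box v \<nu>"
      by blast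
  qed
qed

lemma child_bounds:
  assumes "a $ i < b $ i" "0 < v $ i" "v $ i < 1"
  shows "a $ i \<le> child_lower v a b \<nu> $ i" "child_lower v a b \<nu> $ i < child_upper v a b \<nu> $ i"
    "child_upper v a b \<nu> $ i \<le> b $ i"
proof -
  define t where "t = (b $ i - a $ i) * v $ i"
  have *: "0 < t" "t < b $ i - a $ i"
    using assms by (simp_all add: t_def)
  have "child_lower v a b \<nu> $ i = (if \<nu> $ i then a $ i + t else a $ i)"
    "child_upper v a b \<nu> $ i = (if \<nu> $ i then b $ i else a $ i + t)"
    by (simp_all add: child_lower_def child_upper_def cell_def t_def)
  then show "a $ i \<le> child_lower v a b \<nu> $ i" "child_lower v a b \<nu> $ i < child_upper v a b \<nu> $ i"
    "child_upper v a b \<nu> $ i \<le> b $ i"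
    using * by simp_all
qed

text \<open>The cell at 0 splits at the new scale \<open>v $ i * U\<close> into the new cell at 0
  and one beyond it. Any other side was beyond the larger scale \<open>U\<close> already.\<close>

lemma grid_cell_child:
  assumes "grid_cell U (a $ i) (b $ i)" "0 < v $ i" "v $ i < 1" "0 < U"
  shows "grid_cell (v $ i * U) (child_lower v a b \<nu> $ i) (child_upper v a b \<nu> $ i)"
proof -
  have ab: "0 \<le> a $ i" "a $ i < b $ i" "b $ i \<le> 1" "a $ i = 0 \<and> b $ i = U \<or> U \<le> a $ i"
    using assms by (auto simp: grid_cell_def)
  have vU: "v $ i * U \<le> U"
    using assms by simp
  note ch = child_bounds[of a i b v \<nu>, OF ab(2) assms(2,3)]
  from ab(4) show ?thesis
  proof
    assume "a $ i = 0 \<and> b $ i = U"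
    then show ?thesis
      using ch ab mult_le_one[of "b $ i" "v $ i"] assms
      by (auto simp: grid_cell_def child_lower_def child_upper_def cell_def mult.commute)
  next
    assume "U \<le> a $ i"
    then show ?thesis
      using ch ab vU unfolding grid_cell_def by linarith
  qed
qed

text \<open>Children of different boxes inherit disjoint interiors from their parents. Children of
  one box differ in some vertex coordinate, where their sides meet only in the split point.\<close>

lemma tnest_grid_division:
  fixes v :: "real ^ 'r::finite"
  assumes G: "G division_of unit_cube" and v: "\<And>i. 0 < v $ i" "\<And>i. v $ i < 1"
    and cells: "\<And>J. J \<in> G \<Longrightarrow> \<exists>a b. J = cbox a b \<and> (\<forall>i. a $ i < b $ i)"
  shows "tnest_grid v G division_of unit_cube"
proof (rule division_ofI)
  have grid: "tnest_grid v G = (\<Union>J\<in>G. range (\<lambda>\<nu>. box_map J ` vertex_box v \<nu>))"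
    unfolding tnest_grid_def by (auto simp: image_def)
  show "finite (tnest_grid v G)"
    unfolding grid using division_ofD(1)[OF G] by auto
  have child: "\<exists>J a b \<nu>. J \<in> G \<and> J = cbox a b \<and> (\<forall>i. a $ i < b $ i) \<and>
      K = cbox (child_lower v a b \<nu>) (child_upper v a b \<nu>)" if "K \<in> tnest_grid v G" for K
  proof -
    obtain J \<nu> where J: "J \<in> G" "K = box_map J ` vertex_box v \<nu>"
      using \<open>K \<in> tnest_grid v G\<close> unfolding grid by blast
    obtain a b where ab: "J = cbox a b" "\<forall>i. a $ i < b $ i"
      using cells[OF J(1)] by blast
    then show ?thesis
      using J box_map_vertex_box[of a b v \<nu>] by metis
  qed
  have sub: "cbox (child_lower v a b \<nu>) (child_upper v a b \<nu>) \<subseteq> cbox a b"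
    if "\<forall>i. a $ i < b $ i" for a b \<nu>
  proof
    fix p assume p: "p \<in> cbox (child_lower v a b \<nu>) (child_upper v a b \<nu>)"
    have "a $ i \<le> p $ i \<and> p $ i \<le> b $ i" for i
      using p child_bounds[of a i b v \<nu>] that v[of i] unfolding mem_box_cart
      by (meson order_trans)
    then show "p \<in> cbox a b"
      by (simp add: mem_box_cart)
  qed
  show "K \<subseteq> unit_cube" if "K \<in> tnest_grid v G" for K
    using child[OF that] sub division_ofD(2)[OF G] by blast
  show "K \<noteq> {}" if K: "K \<in> tnest_grid v G" for K
  proof -
    obtain a b \<nu> where ab: "\<forall>i. a $ i < b $ i" "K = cbox (child_lower v a b \<nu>) (child_upper v a b \<nu>)"
      using child[OF K] by blast
    then have "child_lower v a b \<nu> \<in> K"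
      using child_bounds[of a _ b v \<nu>] v by (auto simp: mem_box_cart less_imp_le)
    then show ?thesis
      by blast
  qed
  show "\<exists>a b. K = cbox a b" if "K \<in> tnest_grid v G" for K
    using child[OF that] by blast
  show "interior K1 \<inter> interior K2 = {}" if K: "K1 \<in> tnest_grid v G" "K2 \<in> tnest_grid v G" "K1 \<noteq> K2" for K1 K2
  proof -
    obtain J1 a1 b1 \<nu>1 where 1: "J1 \<in> G" "J1 = cbox a1 b1" "\<forall>i. a1 $ i < b1 $ i"
      "K1 = cbox (child_lower v a1 b1 \<nu>1) (child_upper v a1 b1 \<nu>1)"
      using child[OF K(1)] by blast
    obtain J2 a2 b2 \<nu>2 where 2: "J2 \<in> G" "J2 = cbox a2 b2" "\<forall>i. a2 $ i < b2 $ i"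
      "K2 = cbox (child_lower v a2 b2 \<nu>2) (child_upper v a2 b2 \<nu>2)"
      using child[OF K(2)] by blast
    show ?thesis
    proof (cases "J1 = J2")
      case False
      then have "interior J1 \<inter> interior J2 = {}"
        using division_ofD(5)[OF G] 1 2 by blast
      moreover have "K1 \<subseteq> J1" "K2 \<subseteq> J2"
        using sub 1 2 by simp_all
      then have "interior K1 \<subseteq> interior J1" "interior K2 \<subseteq> interior J2"
        by (simp_all only: interior_mono)
      ultimately show ?thesis
        by blast
    next
      case True
      have "cbox a1 b1 \<noteq> {}"
        using 1(3) by (auto simp: interval_ne_empty_cart less_imp_le)
      \<comment> \<open>A nonempty box determines its corners, so the two children can differ only
        in their vertices.\<close>
      then have eq: "a2 = a1" "b2 = b1"
        using True 1(2) 2(2) by (auto simp: eq_cbox)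
      with K(3) 1 2 have "\<nu>1 \<noteq> \<nu>2"
        by auto
      then obtain i where i: "\<nu>1 $ i \<noteq> \<nu>2 $ i"
        by (auto simp: vec_eq_iff)
      show ?thesis
        unfolding 1(4) 2(4) interior_cbox eq disjoint_iff
        using i by (auto simp: mem_box_cart child_lower_def child_upper_def dest!: spec[of _ i] split: if_splits)
    qed
  qed
  show "\<Union>(tnest_grid v G) = unit_cube"
  proof
    show "\<Union>(tnest_grid v G) \<subseteq> unit_cube"
      using child sub division_ofD(2)[OF G] by blast
    show "unit_cube \<subseteq> \<Union>(tnest_grid v G)"
    proof
      fix p :: "real ^ 'r" assume "p \<in> unit_cube"
      then obtain J where J: "J \<in> G" "p \<in> J"
        using division_ofD(6)[OF G] by blast
      obtain a b where ab: "J = cbox a b" "\<forall>i. a $ i < b $ i"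
        using cells[OF J(1)] by blast
      define \<nu> :: "'r vertex" where "\<nu> = (\<chi> i. cell (a $ i) (b $ i) (v $ i) < p $ i)"
      have "child_lower v a b \<nu> $ i \<le> p $ i \<and> p $ i \<le> child_upper v a b \<nu> $ i" for i
        using J(2) unfolding ab by (auto simp: mem_box_cart child_lower_def child_upper_def \<nu>_def) (auto simp: cell_def)
      then have "p \<in> box_map J ` vertex_box v \<nu>"
        using ab by (simp add: box_map_vertex_box mem_box_cart)
      then show "p \<in> \<Union>(tnest_grid v G)"
        unfolding grid using J(1) by blast
    qed
  qed
qed

text \<open>Pulling back inside one child side multiplies Lebesgue measure by a factor that does not
  depend on \<open>B\<close>. This independence is what propagates constant densities from parent to
  child.\<close>

lemma coord_map_child:
  assumes cell: "grid_cell U a b" and v: "0 < v" "v < 1" and U: "0 < U"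
  shows "\<exists>K. \<forall>B. B \<in> sets borel \<longrightarrow>
    B \<subseteq> {cell a b (if \<beta> then v else 0)..cell a b (if \<beta> then 1 else v)} \<longrightarrow>
    coord_map U v \<mu> -` B \<subseteq> {a..b} \<and> measure lborel (coord_map U v \<mu> -` B) = K * measure lborel B"
proof -
  have ab: "0 \<le> a" "a < b" "a = 0 \<and> b = U \<or> U \<le> a"
    using cell by (auto simp: grid_cell_def)
  have "0 < (b - a) * v" "(b - a) * v < b - a"
    using ab v by simp_all
  then have sub: "{cell a b (if \<beta> then v else 0)..cell a b (if \<beta> then 1 else v)} \<subseteq> {a..b}"
    by (auto simp: cell_def)
  from ab(3) show ?thesis
  proof
    assume a: "U \<le> a"
    have "coord_map U v \<mu> -` B = B" if "B \<subseteq> {a..b}" for B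
    proof (intro set_eqI)
      fix w show "w \<in> coord_map U v \<mu> -` B \<longleftrightarrow> w \<in> B"
        using that a coord_map_bounds[OF v, of w U \<mu>]
        by (cases "0 \<le> w \<and> w < U") (auto simp: coord_map_eq_self)
    qed
    then show ?thesis
      using sub by (intro exI[of _ 1]) (metis dual_order.trans mult_1)
  next
    assume a: "a = 0 \<and> b = U"
    \<comment> \<open>The inverse slope of the branch if it maps onto this child. Otherwise the
      branch can meet the child only in the split point, and the factor is 0.\<close>
    define K where "K = of_bool (\<mu> = \<beta>) / (if \<mu> then 1 - v else v)"
    have "coord_map U v \<mu> -` B \<subseteq> {a..b} \<and> measure lborel (coord_map U v \<mu> -` B) = K * measure lborel B"
      if B: "B \<in> sets borel" and Bsub: "B \<subseteq> {cell a b (if \<beta> then v else 0)..cell a b (if \<beta> then 1 else v)}" for B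
    proof
      let ?C = "cell 0 U -` B"
      have C: "?C \<in> sets borel"
        using B by (intro vimage_borel) auto
      show pre: "coord_map U v \<mu> -` B \<subseteq> {a..b}"
      proof
        fix w assume "w \<in> coord_map U v \<mu> -` B"
        then have "coord_map U v \<mu> w \<in> {0..U}"
          using Bsub sub a by auto
        then show "w \<in> {a..b}"
          using a by (cases "0 \<le> w \<and> w < U") (auto simp: coord_map_eq_self)
      qed
      have "coord_map U v \<mu> -` B \<inter> {0..U} = coord_map U v \<mu> -` B"
        using pre a by auto
      moreover have "coord_map U v \<mu> -` B \<in> sets borel"
        using B by (intro vimage_borel) auto
      ultimately have "measure lborel (coord_map U v \<mu> -` B) = U * measure unif01 (cell 0 U -` coord_map U v \<mu> -` B)"
        using U by (subst measure_cell_vimage) auto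
      also have "\<dots> = U * (measure lborel (?C \<inter> branch_ivl v \<mu>) / (if \<mu> then 1 - v else v))"
        using U B C v by (simp add: coord_map_cell_0 measure_branch_vimage)
      also have "measure lborel (?C \<inter> branch_ivl v \<mu>) = of_bool (\<mu> = \<beta>) * measure lborel B / U"
      proof (cases "\<mu> = \<beta>")
        case True
        have "?C \<subseteq> branch_ivl v \<mu>"
        proof
          fix x assume "x \<in> ?C"
          then have "U * x \<in> B"
            by (simp add: cell_def)
          then show "x \<in> branch_ivl v \<mu>"
            using Bsub a U True by (auto simp: cell_def branch_ivl_def zero_le_mult_iff split: if_splits)
        qed
        then have "?C \<inter> branch_ivl v \<mu> = ?C"
          by auto
        moreover have "measure lborel ?C = measure lborel B / U"
          using measure_lborel_affine_vimage[of U B 0] U B by (simp add: cell_def[abs_def])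
        ultimately show ?thesis
          using True by simp
      next
        case False
        have "?C \<inter> branch_ivl v \<mu> \<subseteq> {v}"
        proof
          fix x assume "x \<in> ?C \<inter> branch_ivl v \<mu>"
          then have "U * x \<in> B" "x \<in> branch_ivl v \<mu>"
            by (simp_all add: cell_def)
          then show "x \<in> {v}"
            using Bsub a U False by (cases \<mu>; cases \<beta>) (auto simp: cell_def branch_ivl_def)
        qed
        then have "?C \<inter> branch_ivl v \<mu> = {} \<or> ?C \<inter> branch_ivl v \<mu> = {v}"
          by blast
        then show ?thesis
          using False by (auto simp: measure_def)
      qed
      finally show "measure lborel (coord_map U v \<mu> -` B) = K * measure lborel B"
        using U by (simp add: K_def)
    qed
    then show ?thesis
      by blast
  qed
qed

section \<open>The coupling of the iterates\<close>

locale tail_nesting =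
  fixes k :: nat and u :: "nat \<Rightarrow> real ^ 'r::finite" and z :: "nat \<Rightarrow> 'r vertex \<Rightarrow> real"
  assumes k_le: "k \<le> CARD('r)"
    and u_box: "\<And>n. n \<ge> 1 \<Longrightarrow> u n \<in> box 0 1"
    and z_copula: "\<And>n. n \<ge> 1 \<Longrightarrow> z n \<in> vertex_copulas k (u n)"
begin

lemma u_pos: "0 < u (Suc n) $ i" and u_less_1: "u (Suc n) $ i < 1"
  using u_box[of "Suc n"] by (auto simp: mem_box_cart)

lemma z_nonneg: "0 \<le> z (Suc n) \<nu>"
  using z_copula[of "Suc n"] by (auto simp: vertex_copulas_def)

lemma z_sum: "(\<Sum>\<nu>\<in>UNIV. z (Suc n) \<nu>) = 1"
  using vertex_copula_sum u_box z_copula by (metis le_numeral_extra(4) le_SucI One_nat_def Suc_leI zero_less_Suc)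

definition scale :: "nat \<Rightarrow> 'r \<Rightarrow> real"
  where "scale n i = (\<Prod>l=1..n. u l $ i)"

lemma scale_0 [simp]: "scale 0 i = 1"
  by (simp add: scale_def)

lemma scale_Suc: "scale (Suc n) i = u (Suc n) $ i * scale n i"
  by (simp add: scale_def atLeastAtMostSuc_conv)

lemma scale_pos: "0 < scale n i"
  by (induction n) (simp_all add: scale_Suc u_pos)

lemma scale_antimono: "m \<le> n \<Longrightarrow> scale n i \<le> scale m i"
proof (induction rule: dec_induct)
  case (step n)
  have "scale (Suc n) i \<le> scale n i"
    using u_pos[of n i] u_less_1[of n i] scale_pos[of n i] by (simp add: scale_Suc mult_left_le_one_le)
  with step show ?case
    by simp
qed simp

lemma scale_le_1: "scale n i \<le> 1"
  using scale_antimono[of 0 n i] by simp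

definition refine :: "nat \<Rightarrow> 'r vertex \<Rightarrow> real ^ 'r \<Rightarrow> real ^ 'r"
  where "refine n \<nu> w = (\<chi> i. coord_map (scale n i) (u (Suc n) $ i) (\<nu> $ i) (w $ i))"

text \<open>A path consists of a sequence of vertices and a starting point.  The vertex with index 0 is
  never used; \<open>choice 0\<close> is a probability measure even if \<open>z 0\<close> is not a distribution.\<close>

primrec path :: "(nat \<Rightarrow> 'r vertex) \<times> (real ^ 'r) \<Rightarrow> nat \<Rightarrow> real ^ 'r"
  where
    "path p 0 = snd p"
  | "path p (Suc n) = refine n (fst p (Suc n)) (path p n)"

definition choice :: "nat \<Rightarrow> 'r vertex measure"
  where "choice n = measure_pmf (embed_pmf (z n))"

definition paths :: "((nat \<Rightarrow> 'r vertex) \<times> (real ^ 'r)) measure"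
  where "paths = PiM UNIV choice \<Otimes>\<^sub>M uniform_face (\<chi> i. True)"

definition stage :: "nat \<Rightarrow> (real ^ 'r) measure"
  where "stage n = distr paths borel (\<lambda>p. path p n)"

sublocale choice: prob_space "choice n" for n
  unfolding choice_def by (rule measure_pmf.prob_space_axioms)

sublocale choices: prob_space "PiM UNIV choice"
  by (intro prob_space_PiM choice.prob_space_axioms)

sublocale seed: prob_space "uniform_face (\<chi> i. True) :: (real ^ 'r) measure"
  by (rule uniform_face_prob_space)

sublocale paths: pair_prob_space "PiM UNIV choice" "uniform_face (\<chi> i. True) :: (real ^ 'r) measure" ..

lemma prob_space_paths: "prob_space paths"
  unfolding paths_def by (rule paths.prob_space_axioms)

lemma sets_choice [measurable_cong]: "sets (choice n) = sets (count_space UNIV)"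
  by (simp add: choice_def)

lemma refine_measurable [measurable]: "refine n \<nu> \<in> borel \<rightarrow>\<^sub>M borel"
  unfolding refine_def[abs_def] by (rule borel_measurable_vec_lambda) measurable

lemma measurable_choice: "(\<lambda>p. fst p n) \<in> paths \<rightarrow>\<^sub>M count_space UNIV"
proof -
  have "(\<lambda>f. f n) \<in> PiM UNIV choice \<rightarrow>\<^sub>M choice n"
    by (rule measurable_component_singleton) simp
  then have "(\<lambda>p. fst p n) \<in> paths \<rightarrow>\<^sub>M choice n"
    unfolding paths_def by (rule measurable_compose[OF measurable_fst])
  then show ?thesis
    using measurable_cong_sets[OF refl sets_choice] by blast
qed

lemma path_measurable [measurable]: "(\<lambda>p. path p n) \<in> paths \<rightarrow>\<^sub>M borel"
proof (induction n)
  case 0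
  have "snd \<in> paths \<rightarrow>\<^sub>M (uniform_face (\<chi> i. True) :: (real ^ 'r) measure)"
    unfolding paths_def by (rule measurable_snd)
  then show ?case
    using measurable_cong_sets[OF refl sets_uniform_face] by (simp add: measurable_def)
next
  case (Suc n)
  have "(\<lambda>p. refine n \<nu> (path p n)) \<in> paths \<rightarrow>\<^sub>M borel" for \<nu>
    by (rule measurable_compose[OF Suc refine_measurable])
  then show ?case
    \<comment> \<open>There are only finitely many vertices, so measurability may be checked with
      the vertex held fixed.\<close>
    using measurable_compose_countable[OF _ measurable_choice, of "\<lambda>\<nu> p. refine n \<nu> (path p n)" borel "Suc n"]
    by simp
qed

sublocale stage: prob_space "stage n" for n
  unfolding stage_def by (rule prob_space.prob_space_distr[OF prob_space_paths path_measurable])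

lemma sets_stage [simp, measurable_cong]: "sets (stage n) = sets borel"
  by (simp add: stage_def)

lemma space_stage [simp]: "space (stage n) = UNIV"
  by (simp add: stage_def)

text \<open>The path up to time \<open>n\<close> does not look at later vertices; hence the vertex
  with index \<open>Suc n\<close> is independent of it.\<close>

lemma path_upd: "path (s(m := \<nu>), \<eta>) n = path (s, \<eta>) n" if "n < m"
  using that by (induction n) auto

lemma pmf_choice: "pmf (embed_pmf (z (Suc n))) \<nu> = z (Suc n) \<nu>"
proof (rule pmf_embed_pmf)
  have "(\<Sum>\<nu>\<in>UNIV. ennreal (z (Suc n) \<nu>)) = 1"
    using z_sum[of n] z_nonneg[of n] by (subst sum_ennreal) auto
  then show "(\<integral>\<^sup>+ \<nu>. ennreal (z (Suc n) \<nu>) \<partial>count_space UNIV) = 1"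
    by (simp add: nn_integral_count_space_finite)
qed (rule z_nonneg)

text \<open>The Markov property of the coupling: conditioning on the latest vertex splits the next
  law into images of the present one. All later statements about finite stages use this recursion in
  place of the path space.\<close>

lemma emeasure_stage_Suc:
  assumes A: "A \<in> sets borel"
  shows "emeasure (stage (Suc n)) A = (\<Sum>\<nu>\<in>UNIV. ennreal (z (Suc n) \<nu>) * emeasure (stage n) (refine n \<nu> -` A))"
proof -
  let ?\<Omega> = "PiM UNIV choice" and ?S = "uniform_face (\<chi> i. True) :: (real ^ 'r) measure"
  let ?C = "choice (Suc n)"
  have pre: "refine n \<nu> -` A \<in> sets borel" for \<nu>
    using measurable_sets[OF refine_measurable A] by simp
  have meas: "(\<lambda>p. indicator B (path p m)) \<in> borel_measurable (?\<Omega> \<Otimes>\<^sub>M ?S)" if "B \<in> sets borel" for B m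
    using path_measurable[of m] that unfolding paths_def by measurable
  have stage: "emeasure (stage m) B = (\<integral>\<^sup>+\<eta>. \<integral>\<^sup>+s. indicator B (path (s, \<eta>) m) \<partial>?\<Omega> \<partial>?S)"
    if B: "B \<in> sets borel" for B m
  proof -
    have "emeasure (stage m) B = (\<integral>\<^sup>+p. indicator B (path p m) \<partial>paths)"
      unfolding stage_def using B
      by (subst nn_integral_indicator[symmetric]) (simp_all add: nn_integral_distr del: nn_integral_indicator)
    then show ?thesis
      using paths.nn_integral_snd[OF meas[OF B]] by (simp add: paths_def)
  qed
  have "emeasure (stage (Suc n)) A = (\<integral>\<^sup>+\<eta>. \<integral>\<^sup>+s. indicator A (path (s, \<eta>) (Suc n)) \<partial>?\<Omega> \<partial>?S)"
    by (rule stage[OF A])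
  also have "\<dots> = (\<integral>\<^sup>+\<eta>. (\<Sum>\<nu>\<in>UNIV. ennreal (z (Suc n) \<nu>) *
      (\<integral>\<^sup>+s. indicator (refine n \<nu> -` A) (path (s, \<eta>) n) \<partial>?\<Omega>)) \<partial>?S)"
  proof (intro nn_integral_cong)
    fix \<eta> :: "real ^ 'r"
    have slice: "(\<lambda>s. indicator B (path (s, \<eta>) m)) \<in> borel_measurable ?\<Omega>" if "B \<in> sets borel" for B m
      using measurable_compose[OF measurable_Pair2' meas[OF that]] by simp
    \<comment> \<open>Overwriting one coordinate by an independent sample of the same law does not
      change the product measure.\<close>
    have upd: "?\<Omega> = distr (?C \<Otimes>\<^sub>M ?\<Omega>) ?\<Omega> (\<lambda>(\<nu>, s). s(Suc n := \<nu>))"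
      using distr_pair_PiM_eq_PiM[of UNIV choice "Suc n"] choice.prob_space_axioms by simp
    have upd_measurable: "(\<lambda>(\<nu>, s). s(Suc n := \<nu>)) \<in> ?C \<Otimes>\<^sub>M ?\<Omega> \<rightarrow>\<^sub>M ?\<Omega>"
      using measurable_add_dim[of "Suc n" UNIV choice]
        measurable_compose[OF measurable_pair_swap' measurable_add_dim[of "Suc n" UNIV choice]]
      by (simp add: split_beta')
    have "(\<integral>\<^sup>+s. indicator A (path (s, \<eta>) (Suc n)) \<partial>?\<Omega>) =
        (\<integral>\<^sup>+(\<nu>, s). indicator A (path (s(Suc n := \<nu>), \<eta>) (Suc n)) \<partial>(?C \<Otimes>\<^sub>M ?\<Omega>))"
      by (subst upd, subst nn_integral_distr[OF upd_measurable])
        (use slice[OF A] in \<open>auto simp: split_beta' simp del: path.simps\<close>)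
    also have "\<dots> = (\<integral>\<^sup>+\<nu>. \<integral>\<^sup>+s. indicator A (path (s(Suc n := \<nu>), \<eta>) (Suc n)) \<partial>?\<Omega> \<partial>?C)"
      using choices.nn_integral_fst[OF measurable_compose[OF upd_measurable slice[OF A, of "Suc n"]]]
      by (simp add: split_beta' del: path.simps)
    also have "\<dots> = (\<Sum>\<nu>\<in>UNIV. (\<integral>\<^sup>+s. indicator A (path (s(Suc n := \<nu>), \<eta>) (Suc n)) \<partial>?\<Omega>) * ennreal (z (Suc n) \<nu>))"
      unfolding choice_def by (subst nn_integral_measure_pmf_support[of UNIV]) (auto simp: pmf_choice)
    also have "\<dots> = (\<Sum>\<nu>\<in>UNIV. ennreal (z (Suc n) \<nu>) * (\<integral>\<^sup>+s. indicator (refine n \<nu> -` A) (path (s, \<eta>) n) \<partial>?\<Omega>))"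
      by (simp add: path_upd mult.commute indicator_vimage)
    finally show "(\<integral>\<^sup>+s. indicator A (path (s, \<eta>) (Suc n)) \<partial>?\<Omega>) =
      (\<Sum>\<nu>\<in>UNIV. ennreal (z (Suc n) \<nu>) * (\<integral>\<^sup>+s. indicator (refine n \<nu> -` A) (path (s, \<eta>) n) \<partial>?\<Omega>))" .
  qed
  also have "\<dots> = (\<Sum>\<nu>\<in>UNIV. ennreal (z (Suc n) \<nu>) *
      (\<integral>\<^sup>+\<eta>. \<integral>\<^sup>+s. indicator (refine n \<nu> -` A) (path (s, \<eta>) n) \<partial>?\<Omega> \<partial>?S))"
  proof -
    have "(\<lambda>\<eta>. \<integral>\<^sup>+s. indicator (refine n \<nu> -` A) (path (s, \<eta>) n) \<partial>?\<Omega>) \<in> borel_measurable ?S" for \<nu>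
      using choices.borel_measurable_nn_integral_fst[OF
          measurable_compose[OF measurable_pair_swap' meas[OF pre]]]
      by (simp add: split_beta')
    then show ?thesis
      by (subst nn_integral_sum) (simp_all add: nn_integral_cmult)
  qed
  finally show ?thesis
    by (simp only: stage[OF pre])
qed

lemma measure_stage_Suc:
  assumes "A \<in> sets borel"
  shows "measure (stage (Suc n)) A = (\<Sum>\<nu>\<in>UNIV. z (Suc n) \<nu> * measure (stage n) (refine n \<nu> -` A))"
proof (rule measure_eq_emeasure_eq_ennreal)
  show "emeasure (stage (Suc n)) A = ennreal (\<Sum>\<nu>\<in>UNIV. z (Suc n) \<nu> * measure (stage n) (refine n \<nu> -` A))"
    unfolding emeasure_stage_Suc[OF assms]
    by (subst sum_ennreal[symmetric]) (simp_all add: stage.emeasure_eq_measure ennreal_mult z_nonneg)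
qed (simp add: sum_nonneg z_nonneg)

lemma refine_vimage_rect:
  "refine n \<nu> -` rect B = rect (\<lambda>i. coord_map (scale n i) (u (Suc n) $ i) (\<nu> $ i) -` B i)"
  by (auto simp: refine_def)

lemma measure_stage_Suc_rect:
  assumes "\<And>i. B i \<in> sets borel"
  shows "measure (stage (Suc n)) (rect B) =
    (\<Sum>\<nu>\<in>UNIV. z (Suc n) \<nu> *
      measure (stage n) (rect (\<lambda>i. coord_map (scale n i) (u (Suc n) $ i) (\<nu> $ i) -` B i)))"
  using assms by (simp add: measure_stage_Suc refine_vimage_rect)

lemma stage_0: "stage 0 = uniform_face (\<chi> i. True)"
proof (rule measure_eqI)
  fix A :: "(real ^ 'r) set" assume "A \<in> sets (stage 0)"
  moreover have "snd -` A \<inter> space paths = space (PiM UNIV choice) \<times> A"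
    by (auto simp: paths_def space_pair_measure)
  ultimately show "emeasure (stage 0) A = emeasure (uniform_face (\<chi> i. True)) A"
    using path_measurable[of 0] choices.emeasure_space_1
    by (simp add: stage_def emeasure_distr) (simp add: paths_def seed.emeasure_pair_measure_Times)
qed simp

lemma measure_stage_0_rect:
  assumes "\<And>i. B i \<in> sets borel"
  shows "measure (stage 0) (rect B) = (\<Prod>i\<in>UNIV. measure unif01 (B i))"
  using assms by (simp add: stage_0 measure_uniform_face_rect)

lemma measure_stage_cube: "measure (stage n) unit_cube = 1"
proof (induction n)
  case 0
  then show ?case
    by (simp add: cbox_eq_rect measure_stage_0_rect measure_unif01)
next
  case (Suc n)
  have "coord_map (scale n i) (u (Suc n) $ i) b -` {0..1} = {0..1}" for i b
  proof -
    have "0 \<le> coord_map (scale n i) (u (Suc n) $ i) b w \<and> coord_map (scale n i) (u (Suc n) $ i) b w \<le> 1 \<longleftrightarrow> 0 \<le> w \<and> w \<le> 1" for w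
      using coord_map_bounds[OF u_pos[of n i] u_less_1[of n i], of w "scale n i" b] scale_le_1[of n i]
      by (cases "0 \<le> w \<and> w < scale n i") (auto simp: coord_map_eq_self)
    then show ?thesis
      by auto
  qed
  then show ?case
    using Suc by (simp add: cbox_eq_rect measure_stage_Suc_rect z_sum flip: sum_distrib_right)
qed

text \<open>\<open>grid n\<close> has been subdivided \<open>n\<close> times, so the vertex grid
  that starts \<open>tnest_iter\<close> is \<open>grid 1\<close>.\<close>

primrec grid :: "nat \<Rightarrow> (real ^ 'r) set set"
  where
    "grid 0 = {unit_cube}"
  | "grid (Suc n) = tnest_grid (u (Suc n)) (grid n)"

text \<open>A rectangle in a child box pulls back, for every vertex, to a rectangle in the parent
  box, whose constant density is multiplied by one factor per coordinate. Mixing over the vertices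
  again gives a constant.\<close>

lemma grid_uniform_cell:
  assumes "J \<in> grid n"
  shows "\<exists>a b. J = cbox a b \<and> (\<forall>i. grid_cell (scale n i) (a $ i) (b $ i)) \<and> uniform_on (stage n) J"
  using assms
proof (induction n arbitrary: J)
  case 0
  have "uniform_on (stage 0) (cbox 0 1)"
  proof (rule uniform_onI_rect[where c = 1])
    fix B :: "'r \<Rightarrow> real set"
    assume B: "\<And>i. B i \<in> sets borel" "\<And>i. B i \<subseteq> {0 $ i..1 $ i}"
    then have "measure unif01 (B i) = measure lborel (B i)" for i
      by (simp add: measure_unif01 Int_absorb1 Int_absorb2)
    then show "measure (stage 0) (rect B) = 1 * (\<Prod>i\<in>UNIV. measure lborel (B i))"
      using B by (simp add: measure_stage_0_rect)
  qed (simp_all add: stage.finite_measure_axioms)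
  then show ?case
    using 0 by (intro exI[of _ 0] exI[of _ 1]) (simp add: grid_cell_def)
next
  case (Suc n)
  then obtain J0 \<nu> where J0: "J0 \<in> grid n" "J = box_map J0 ` vertex_box (u (Suc n)) \<nu>"
    by (auto simp: tnest_grid_def)
  obtain a b where ab: "J0 = cbox a b" "\<And>i. grid_cell (scale n i) (a $ i) (b $ i)" "uniform_on (stage n) J0"
    using Suc.IH[OF J0(1)] by blast
  have less: "a $ i < b $ i" for i
    using ab(2)[of i] by (simp add: grid_cell_def)
  let ?l = "child_lower (u (Suc n)) a b \<nu>" and ?h = "child_upper (u (Suc n)) a b \<nu>"
  have J: "J = cbox ?l ?h"
    using J0(2) unfolding ab(1) by (simp add: box_map_vertex_box less)
  have cells: "grid_cell (scale (Suc n) i) (?l $ i) (?h $ i)" for i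
    unfolding scale_Suc using ab(2) u_pos u_less_1 scale_pos by (rule grid_cell_child)
  obtain c where c: "\<And>A. A \<in> sets borel \<Longrightarrow> A \<subseteq> J0 \<Longrightarrow> measure (stage n) A = c * measure lborel A"
    using ab(3) by (auto simp: uniform_on_def)
  have "\<forall>i \<mu>. \<exists>K. \<forall>B. B \<in> sets borel \<longrightarrow> B \<subseteq> {?l $ i..?h $ i} \<longrightarrow>
      coord_map (scale n i) (u (Suc n) $ i) \<mu> -` B \<subseteq> {a $ i..b $ i} \<and>
      measure lborel (coord_map (scale n i) (u (Suc n) $ i) \<mu> -` B) = K * measure lborel B"
    unfolding child_lower_def child_upper_def vec_lambda_beta
    by (intro allI coord_map_child ab(2) u_pos u_less_1 scale_pos)
  then obtain K where K: "\<And>i \<mu> B. B \<in> sets borel \<Longrightarrow> B \<subseteq> {?l $ i..?h $ i} \<Longrightarrow>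
      coord_map (scale n i) (u (Suc n) $ i) \<mu> -` B \<subseteq> {a $ i..b $ i} \<and>
      measure lborel (coord_map (scale n i) (u (Suc n) $ i) \<mu> -` B) = K i \<mu> * measure lborel B"
    by metis
  have "uniform_on (stage (Suc n)) (cbox ?l ?h)"
  proof (rule uniform_onI_rect)
    show "?l $ i < ?h $ i" for i
      using cells[of i] by (simp add: grid_cell_def)
    fix B :: "'r \<Rightarrow> real set"
    assume B: "\<And>i. B i \<in> sets borel" "\<And>i. B i \<subseteq> {?l $ i..?h $ i}"
    have pre: "coord_map (scale n i) (u (Suc n) $ i) \<mu> -` B i \<in> sets borel" for i \<mu>
      using B(1) by (intro vimage_borel) auto
    have "measure (stage n) (rect (\<lambda>i. coord_map (scale n i) (u (Suc n) $ i) (\<mu> $ i) -` B i)) =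
        c * ((\<Prod>i\<in>UNIV. K i (\<mu> $ i)) * (\<Prod>i\<in>UNIV. measure lborel (B i)))" for \<mu>
    proof -
      have "rect (\<lambda>i. coord_map (scale n i) (u (Suc n) $ i) (\<mu> $ i) -` B i) \<subseteq> J0"
        unfolding ab(1) cbox_eq_rect rect_def using K[OF B] by blast
      then have "measure (stage n) (rect (\<lambda>i. coord_map (scale n i) (u (Suc n) $ i) (\<mu> $ i) -` B i)) =
          c * measure lborel (rect (\<lambda>i. coord_map (scale n i) (u (Suc n) $ i) (\<mu> $ i) -` B i))"
        using pre by (intro c) auto
      also have "measure lborel (rect (\<lambda>i. coord_map (scale n i) (u (Suc n) $ i) (\<mu> $ i) -` B i)) =
          (\<Prod>i\<in>UNIV. K i (\<mu> $ i) * measure lborel (B i))"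
        using pre K[OF B] by (simp add: measure_lborel_rect)
      finally show ?thesis
        by (simp add: prod.distrib)
    qed
    then show "measure (stage (Suc n)) (rect B) =
        (\<Sum>\<mu>\<in>UNIV. z (Suc n) \<mu> * (c * (\<Prod>i\<in>UNIV. K i (\<mu> $ i)))) * (\<Prod>i\<in>UNIV. measure lborel (B i))"
      using B(1) by (simp add: measure_stage_Suc_rect sum_distrib_right sum_distrib_left mult_ac)
  qed (simp_all add: stage.finite_measure_axioms)
  then show ?case
    using J cells by blast
qed

lemma grid_division: "grid n division_of unit_cube"
proof (induction n)
  case 0
  have "(unit_cube :: (real ^ 'r) set) \<noteq> {}"
    by (auto simp: interval_ne_empty_cart)
  then show ?case
    by (simp add: division_of_self)
next
  case (Suc n)
  show ?case
    unfolding grid.simps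
  proof (rule tnest_grid_division[OF Suc u_pos u_less_1])
    show "\<exists>a b. J = cbox a b \<and> (\<forall>i. a $ i < b $ i)" if "J \<in> grid n" for J
      using grid_uniform_cell[OF that] by (auto simp: grid_cell_def)
  qed
qed

definition lo :: "(real ^ 'r) set \<Rightarrow> 'r \<Rightarrow> real"
  where "lo J i = interval_lowerbound J $ i"

definition hi :: "(real ^ 'r) set \<Rightarrow> 'r \<Rightarrow> real"
  where "hi J i = interval_upperbound J $ i"

lemma grid_lo_hi:
  assumes "J \<in> grid n"
  shows "J = rect (\<lambda>i. {lo J i..hi J i})" "grid_cell (scale n i) (lo J i) (hi J i)"
    "box_map J p = (\<chi> i. cell (lo J i) (hi J i) (p $ i))"
    "box_vertex J $ i \<longleftrightarrow> lo J i \<noteq> 0"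
proof -
  obtain a b where ab: "J = cbox a b" "\<And>i. grid_cell (scale n i) (a $ i) (b $ i)"
    using grid_uniform_cell[OF assms] by blast
  have le: "a $ i \<le> b $ i" "0 \<le> a $ i" for i
    using ab(2)[of i] by (simp_all add: grid_cell_def)
  then have "cbox a b \<noteq> {}"
    by (auto simp: interval_ne_empty_cart)
  then have lohi: "lo J i = a $ i" "hi J i = b $ i" for i
    unfolding lo_def hi_def ab(1) by (simp_all add: interval_bounds')
  show "J = rect (\<lambda>i. {lo J i..hi J i})" "grid_cell (scale n i) (lo J i) (hi J i)"
    "box_map J p = (\<chi> i. cell (lo J i) (hi J i) (p $ i))"
    "box_vertex J $ i \<longleftrightarrow> lo J i \<noteq> 0"
    unfolding lohi using ab le by (simp_all add: cbox_eq_rect box_map_cbox flip: cbox_eq_rect)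
      (simp add: box_vertex_cbox)
qed

text \<open>Sampling form of a grid copula: pick a box according to its mass, then independent
  uniform points on its sides.\<close>

lemma measure_stage_rect:
  assumes B: "\<And>i. B i \<in> sets borel"
  shows "measure (stage n) (rect B) =
    (\<Sum>J\<in>grid n. measure (stage n) J * (\<Prod>i\<in>UNIV. measure unif01 (cell (lo J i) (hi J i) -` B i)))"
proof -
  have "measure (stage n) (rect B) = (\<Sum>J\<in>grid n. measure (stage n) (rect B \<inter> J))"
    using grid_uniform_cell B
    by (intro uniform_on_division_sum stage.prob_space_axioms sets_stage measure_stage_cube grid_division) auto
  also have "\<dots> = (\<Sum>J\<in>grid n. measure (stage n) J * (\<Prod>i\<in>UNIV. measure unif01 (cell (lo J i) (hi J i) -` B i)))"
  proof (intro sum.cong refl)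
    fix J assume J: "J \<in> grid n"
    note rect = grid_lo_hi(1)[OF J]
    have less: "lo J i < hi J i" for i
      using grid_lo_hi(2)[OF J] by (simp add: grid_cell_def)
    obtain c where c: "\<And>A. A \<in> sets borel \<Longrightarrow> A \<subseteq> J \<Longrightarrow> measure (stage n) A = c * measure lborel A"
      using grid_uniform_cell[OF J] by (auto simp: uniform_on_def)
    have Jb: "J \<in> sets borel"
      by (subst rect) auto
    have eq: "rect B \<inter> J = rect (\<lambda>i. B i \<inter> {lo J i..hi J i})"
      by (subst rect) (simp add: rect_Int)
    have "measure (stage n) (rect B \<inter> J) = c * measure lborel (rect B \<inter> J)"
      using B Jb by (intro c) auto
    also have "measure lborel (rect B \<inter> J) = (\<Prod>i\<in>UNIV. measure lborel (B i \<inter> {lo J i..hi J i}))"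
      unfolding eq using B by (intro measure_lborel_rect) auto
    also have "\<dots> = (\<Prod>i\<in>UNIV. (hi J i - lo J i) * measure unif01 (cell (lo J i) (hi J i) -` B i))"
    proof (intro prod.cong refl)
      show "measure lborel (B i \<inter> {lo J i..hi J i}) = (hi J i - lo J i) * measure unif01 (cell (lo J i) (hi J i) -` B i)" for i
        using less[of i] B by (simp add: measure_cell_vimage)
    qed
    also have "c * \<dots> = (c * (\<Prod>i\<in>UNIV. hi J i - lo J i)) * (\<Prod>i\<in>UNIV. measure unif01 (cell (lo J i) (hi J i) -` B i))"
      by (simp add: prod.distrib)
    also have "c * (\<Prod>i\<in>UNIV. hi J i - lo J i) = measure (stage n) J"
    proof -
      have "measure (stage n) J = c * measure lborel J"
        using Jb by (intro c) auto
      also have "measure lborel J = (\<Prod>i\<in>UNIV. hi J i - lo J i)"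
        using less by (subst rect) (simp add: measure_lborel_rect less_imp_le)
      finally show ?thesis ..
    qed
    finally show "measure (stage n) (rect B \<inter> J) =
        measure (stage n) J * (\<Prod>i\<in>UNIV. measure unif01 (cell (lo J i) (hi J i) -` B i))" .
  qed
  finally show ?thesis .
qed

text \<open>Identifies the given definition with the grid-free step. In each box both sides are
  mixtures over the same vertex law of products over coordinates, so a comparison of single factors
  suffices.\<close>

lemma tnest_stage: "tnest (u (Suc n)) (z (Suc n)) (grid n) (stage n) = stage (Suc n)"
proof -
  let ?v = "u (Suc n)" and ?z = "z (Suc n)"
  let ?m = "vertex_measure ?v ?z"
  let ?N = "\<lambda>J. distr (face_product (box_vertex J) ?m) borel (box_map J)"
  let ?T = "tnest ?v ?z (grid n) (stage n)"
  have m: "prob_space ?m"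
    using z_copula[of "Suc n"] by (simp add: vertex_copulas_def copula_of_order_def)
  have N: "prob_space (?N J)" for J
    by (intro prob_space.prob_space_distr prob_space_face_product m) simp_all
  have T: "emeasure ?T A = ennreal (\<Sum>J\<in>grid n. measure (stage n) J * measure (?N J) A)"
    if "A \<in> sets borel" for A
  proof -
    have "emeasure (?N J) A = ennreal (measure (?N J) A)" for J
      using N[of J] by (simp add: finite_measure.emeasure_eq_measure prob_space_def)
    then show ?thesis
      using division_of_finite[OF grid_division] that
      by (subst sum_ennreal[symmetric]) (simp_all add: emeasure_tnest stage.emeasure_eq_measure ennreal_mult)
  qed
  have sp: "space ?T = UNIV"
    using sets_eq_imp_space_eq[OF sets_tnest] by simp
  show ?thesis
  proof (rule measure_eqI_rect)
    show "finite_measure ?T"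
      by (intro finite_measureI) (simp add: sp T)
    fix B :: "'r \<Rightarrow> real set" assume B: "\<And>i. B i \<in> sets borel"
    have cellB: "cell a b -` B i \<in> sets borel" for a b i
      using B by (intro vimage_borel) auto
    have one: "measure unif01 UNIV = 1"
      using prob_space.prob_space[OF prob_space_unif01] by simp
    have NJ: "measure (?N J) (rect B) = (\<Sum>\<mu>\<in>UNIV. ?z \<mu> * (\<Prod>i\<in>UNIV.
        measure unif01 (cell (lo J i) (hi J i) -` coord_map (scale n i) (?v $ i) (\<mu> $ i) -` B i)))"
      if J: "J \<in> grid n" for J
    proof -
      let ?\<nu> = "box_vertex J" and ?C = "\<lambda>i. cell (lo J i) (hi J i) -` B i"
      have "box_map J -` rect B \<inter> space (face_product ?\<nu> ?m) = rect ?C"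
        using sets_eq_imp_space_eq[OF sets_face_product, of ?\<nu> ?m] by (auto simp: grid_lo_hi(3)[OF J])
      then have "measure (?N J) (rect B) = measure (face_product ?\<nu> ?m) (rect ?C)"
        using B by (simp add: measure_distr)
      also have "\<dots> = measure ?m (rect (\<lambda>i. if ?\<nu> $ i then UNIV else ?C i)) *
          (\<Prod>i\<in>UNIV. if ?\<nu> $ i then measure unif01 (?C i) else 1)"
        using cellB by (intro measure_face_product_rect m) simp_all
      also have "measure ?m (rect (\<lambda>i. if ?\<nu> $ i then UNIV else ?C i)) =
          (\<Sum>\<mu>\<in>UNIV. ?z \<mu> * (\<Prod>i\<in>UNIV. measure unif01 (branch (?v $ i) (\<mu> $ i) -` (if ?\<nu> $ i then UNIV else ?C i))))"
        using cellB u_box z_nonneg by (intro measure_vertex_measure_rect) auto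
      also have "\<dots> * (\<Prod>i\<in>UNIV. if ?\<nu> $ i then measure unif01 (?C i) else 1) = (\<Sum>\<mu>\<in>UNIV. ?z \<mu> * (\<Prod>i\<in>UNIV.
          measure unif01 (branch (?v $ i) (\<mu> $ i) -` (if ?\<nu> $ i then UNIV else ?C i)) * (if ?\<nu> $ i then measure unif01 (?C i) else 1)))"
        by (simp only: sum_distrib_right prod.distrib mult.assoc)
      also have "\<dots> = (\<Sum>\<mu>\<in>UNIV. ?z \<mu> * (\<Prod>i\<in>UNIV.
          measure unif01 (cell (lo J i) (hi J i) -` coord_map (scale n i) (?v $ i) (\<mu> $ i) -` B i)))"
      proof (intro sum.cong prod.cong refl arg_cong2[where f = "(*)"])
        fix \<mu> :: "'r vertex" and i
        have cell: "lo J i < hi J i" "lo J i = 0 \<and> hi J i = scale n i \<or> scale n i \<le> lo J i"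
          using grid_lo_hi(2)[OF J] by (auto simp: grid_cell_def)
        show "measure unif01 (branch (?v $ i) (\<mu> $ i) -` (if ?\<nu> $ i then UNIV else ?C i)) *
            (if ?\<nu> $ i then measure unif01 (?C i) else 1) =
          measure unif01 (cell (lo J i) (hi J i) -` coord_map (scale n i) (?v $ i) (\<mu> $ i) -` B i)"
        \<comment> \<open>If the side is away from 0, the vertex measure contributes 1 and the fresh
          uniform factor equals that of the unmoved coordinate. If the side is the cell at 0, the
          second factor is 1 and the first is a rescaled branch.\<close>
        proof (cases "?\<nu> $ i")
          case True
          then show ?thesis
            using cell grid_lo_hi(4)[OF J, of i] B by (simp add: one coord_map_cell_ge)
        next
          case False
          then have "lo J i = 0" "hi J i = scale n i"
            using cell grid_lo_hi(4)[OF J, of i] scale_pos[of n i] by auto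
          then show ?thesis
            using False B scale_pos by (simp add: coord_map_cell_0)
        qed
      qed
      finally show ?thesis .
    qed
    have "measure ?T (rect B) = (\<Sum>J\<in>grid n. measure (stage n) J * measure (?N J) (rect B))"
      using B by (intro measure_eq_emeasure_eq_ennreal T sum_nonneg) auto
    also have "\<dots> = (\<Sum>J\<in>grid n. \<Sum>\<mu>\<in>UNIV. ?z \<mu> * (measure (stage n) J * (\<Prod>i\<in>UNIV.
        measure unif01 (cell (lo J i) (hi J i) -` coord_map (scale n i) (?v $ i) (\<mu> $ i) -` B i))))"
      by (simp add: NJ sum_distrib_left mult_ac)
    \<comment> \<open>Exchanging boxes and vertices turns the box-wise replacement into one global
      refinement.\<close>
    also have "\<dots> = (\<Sum>\<mu>\<in>UNIV. ?z \<mu> * measure (stage n) (rect (\<lambda>i. coord_map (scale n i) (?v $ i) (\<mu> $ i) -` B i)))"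
      using B by (subst sum.swap) (simp add: measure_stage_rect vimage_borel sum_distrib_left)
    also have "\<dots> = measure (stage (Suc n)) (rect B)"
      using B by (simp add: measure_stage_Suc_rect)
    finally show "measure ?T (rect B) = measure (stage (Suc n)) (rect B)" .
  qed (simp_all add: stage.finite_measure_axioms)
qed

lemma vertex_measure_eq_stage_1: "vertex_measure (u 1) (z 1) = stage 1"
proof (rule measure_eqI_rect)
  show "finite_measure (vertex_measure (u 1) (z 1))"
    using z_copula[of 1] by (simp add: vertex_copulas_def copula_of_order_def prob_space_def)
  fix B :: "'r \<Rightarrow> real set" assume B: "\<And>i. B i \<in> sets borel"
  have "cell 0 1 = (\<lambda>x. x)"
    by (simp add: cell_def fun_eq_iff)
  then have "measure unif01 (coord_map 1 v b -` B i) = measure unif01 (branch v b -` B i)" for v b i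
    using coord_map_cell_0[of 1 "B i" v b] B by simp
  then show "measure (vertex_measure (u 1) (z 1)) (rect B) = measure (stage 1) (rect B)"
    using B z_nonneg[of 0] u_box[of 1]
    by (simp add: measure_vertex_measure_rect measure_stage_Suc_rect measure_stage_0_rect vimage_borel)
qed (simp_all add: stage.finite_measure_axioms)

lemma vertex_grid_eq_grid_1: "vertex_grid (u 1) = grid 1"
proof -
  have "box_map unit_cube = (id :: real ^ 'r \<Rightarrow> real ^ 'r)"
    by (auto simp: box_map_cbox cell_def vec_eq_iff fun_eq_iff)
  then show ?thesis
    by (auto simp: vertex_grid_def tnest_grid_def)
qed

text \<open>The offset arises because \<open>tnest_iter\<close> starts at c^1, while the coupling
  starts at the uniform law.\<close>

lemma tnest_iter_eq: "tnest_iter u z n = (stage (Suc n), grid (Suc n))"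
proof (induction n)
  case 0
  then show ?case
    using vertex_measure_eq_stage_1 vertex_grid_eq_grid_1 by simp
next
  case (Suc n)
  then show ?case
    using tnest_stage[of "Suc n"] by simp
qed

text \<open>The refinement is invisible on \<open>B\<close> outside \<open>A\<close>, so only at
  most \<open>k\<close> bits matter. These are independent, and each restores the uniform law of its
  side. It serves both the marginals, with sides \<open>UNIV\<close>, and local uniformity, with
  sides beyond the scale.\<close>

lemma measure_stage_Suc_rect_eq:
  assumes A: "card A \<le> k" and B: "\<And>i. B i \<in> sets borel"
    and fixed: "\<And>i b. i \<notin> A \<Longrightarrow> coord_map (scale n i) (u (Suc n) $ i) b -` B i = B i"
  shows "measure (stage (Suc n)) (rect B) = measure (stage n) (rect B)"
proof -
  let ?q = "\<lambda>J i b. measure unif01 (cell (lo J i) (hi J i) -` coord_map (scale n i) (u (Suc n) $ i) b -` B i)"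
  let ?r = "\<lambda>J i. measure unif01 (cell (lo J i) (hi J i) -` B i)"
  have split: "(\<Prod>i\<in>UNIV. f i) = (\<Prod>i\<in>-A. f i) * (\<Prod>i\<in>A. f i)" for f :: "'r \<Rightarrow> real"
    using prod.union_disjoint[of "-A" A f] by (simp add: Compl_partition2)
  have q: "(\<Prod>i\<in>UNIV. ?q J i (\<nu> $ i)) = (\<Prod>i\<in>-A. ?r J i) * (\<Prod>i\<in>A. ?q J i (\<nu> $ i))" for J \<nu>
    using fixed by (subst split) simp
  have "measure (stage (Suc n)) (rect B) =
      (\<Sum>\<nu>\<in>UNIV. \<Sum>J\<in>grid n. z (Suc n) \<nu> * (measure (stage n) J * (\<Prod>i\<in>UNIV. ?q J i (\<nu> $ i))))"
    using B by (subst measure_stage_Suc_rect) (simp_all add: measure_stage_rect vimage_borel sum_distrib_left)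
  also have "\<dots> = (\<Sum>J\<in>grid n. measure (stage n) J * (\<Prod>i\<in>-A. ?r J i) *
      (\<Sum>\<nu>\<in>UNIV. z (Suc n) \<nu> * (\<Prod>i\<in>A. ?q J i (\<nu> $ i))))"
    by (subst sum.swap) (simp add: q sum_distrib_left mult_ac)
  also have "\<dots> = (\<Sum>J\<in>grid n. measure (stage n) J * (\<Prod>i\<in>-A. ?r J i) * (\<Prod>i\<in>A. ?r J i))"
  proof (intro sum.cong refl arg_cong2[where f = "(*)"])
    fix J assume J: "J \<in> grid n"
    \<comment> \<open>The probabilities \<open>?q J i b\<close> are the weights of
      \<open>vertex_copula_marginal\<close>; the box \<open>J\<close> is fixed here.\<close>
    have "(\<Sum>\<nu>\<in>UNIV. z (Suc n) \<nu> * (\<Prod>i\<in>A. ?q J i (\<nu> $ i))) =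
        (\<Prod>i\<in>A. u (Suc n) $ i * ?q J i False + (1 - u (Suc n) $ i) * ?q J i True)"
      by (rule vertex_copula_marginal[OF u_box z_copula k_le A])
        (simp_all add: prob_space.prob_le_1[OF prob_space_unif01])
    also have "\<dots> = (\<Prod>i\<in>A. ?r J i)"
      by (intro prod.cong refl coord_map_mix scale_pos u_pos u_less_1 grid_lo_hi(2)[OF J] B)
    finally show "(\<Sum>\<nu>\<in>UNIV. z (Suc n) \<nu> * (\<Prod>i\<in>A. ?q J i (\<nu> $ i))) = (\<Prod>i\<in>A. ?r J i)" .
  qed
  also have "\<dots> = measure (stage n) (rect B)"
    using B by (simp add: measure_stage_rect split[of "?r _"] mult.assoc)
  finally show ?thesis .
qed

lemma measure_stage_marginal:
  assumes A: "card A \<le> k" and B: "\<And>i. B i \<in> sets borel"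
  shows "measure (stage n) (rect (\<lambda>i. if i \<in> A then B i else UNIV)) = (\<Prod>i\<in>A. measure unif01 (B i))"
proof (induction n)
  case 0
  have "measure unif01 UNIV = 1"
    using prob_space.prob_space[OF prob_space_unif01] by simp
  then have "measure unif01 (if i \<in> A then B i else UNIV) = (if i \<in> A then measure unif01 (B i) else 1)" for i
    by simp
  then show ?case
    using B by (simp add: measure_stage_0_rect prod.If_cases)
next
  case (Suc n)
  then show ?case
    using A B by (subst measure_stage_Suc_rect_eq[OF A]) auto
qed

lemma push_along_stage:
  assumes \<nu>: "face_dim \<nu> = k"
  shows "push_along (compl_vertex \<nu>) (stage n) = uniform_face \<nu>"
proof (rule measure_eqI_rect)
  show "finite_measure (push_along (compl_vertex \<nu>) (stage n))" "finite_measure (uniform_face \<nu>)"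
    using prob_space_push_along[OF stage.prob_space_axioms sets_stage] uniform_face_prob_space
    by (auto simp: prob_space_def)
  fix B :: "'r \<Rightarrow> real set" assume B: "\<And>i. B i \<in> sets borel"
  let ?A = "{i. \<nu> $ i}"
  have "rect B \<in> sets borel"
    using B by simp
  then have push: "measure (push_along (compl_vertex \<nu>) (stage n)) (rect B) =
      measure (stage n) (rect (\<lambda>i. if compl_vertex \<nu> $ i then (if 0 \<in> B i then UNIV else {}) else B i))"
    by (simp only: measure_push_along[OF sets_stage] proj_along_vimage_rect)
  show "measure (push_along (compl_vertex \<nu>) (stage n)) (rect B) = measure (uniform_face \<nu>) (rect B)"
  \<comment> \<open>A projected-out coordinate equals 0 on both sides. If some side misses 0, both
    measures vanish; otherwise these sides impose nothing and a marginal on \<open>k\<close>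
    coordinates remains.\<close>
  proof (cases "\<exists>i. \<not> \<nu> $ i \<and> 0 \<notin> B i")
    case True
    then obtain i where i: "\<not> \<nu> $ i" "0 \<notin> B i"
      by blast
    then have "rect (\<lambda>i. if compl_vertex \<nu> $ i then (if 0 \<in> B i then UNIV else {}) else B i) = {}"
      by (auto simp: compl_vertex_def dest!: spec[of _ i])
    moreover have "(\<Prod>i\<in>UNIV. if \<nu> $ i then measure unif01 (B i) else indicator (B i) 0) = (0 :: real)"
      using i by (intro prod_zero) auto
    ultimately show ?thesis
      using push B by (simp add: measure_uniform_face_rect)
  next
    case False
    then have eq: "(\<lambda>i. if compl_vertex \<nu> $ i then (if 0 \<in> B i then UNIV else {}) else B i) =
        (\<lambda>i. if i \<in> ?A then B i else UNIV)"
      by (auto simp: compl_vertex_def fun_eq_iff)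
    have "card ?A \<le> k"
      using \<nu> by (simp add: face_dim_def)
    then have "measure (push_along (compl_vertex \<nu>) (stage n)) (rect B) = (\<Prod>i\<in>?A. measure unif01 (B i))"
      unfolding push eq by (rule measure_stage_marginal[OF _ B])
    also have "\<dots> = (\<Prod>i\<in>UNIV. if \<nu> $ i then measure unif01 (B i) else indicator (B i) 0)"
    proof -
      have "(\<Prod>i\<in>UNIV. if \<nu> $ i then measure unif01 (B i) else indicator (B i) 0) =
          (\<Prod>i\<in>UNIV. if i \<in> ?A then measure unif01 (B i) else 1)"
        using False by (intro prod.cong) auto
      then show ?thesis
        by (simp add: prod.If_cases)
    qed
    finally show ?thesis
      using B by (simp add: measure_uniform_face_rect)
  qed
qed simp_all

section \<open>The limit\<close>

text \<open>The coordinate is still in the cell at 0 and may move. Once it has left, all later cells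
  at 0 are smaller, so it is frozen forever; negative coordinates count as frozen.\<close>

definition alive :: "(nat \<Rightarrow> 'r vertex) \<times> (real ^ 'r) \<Rightarrow> nat \<Rightarrow> 'r \<Rightarrow> bool"
  where "alive p n i \<longleftrightarrow> 0 \<le> path p n $ i \<and> path p n $ i < scale n i"

lemma path_Suc_nth:
  "path p (Suc n) $ i = coord_map (scale n i) (u (Suc n) $ i) (fst p (Suc n) $ i) (path p n $ i)"
  by (simp add: refine_def)

lemma path_not_alive:
  assumes "\<not> alive p n i" "n \<le> m"
  shows "path p m $ i = path p n $ i"
  using assms(2)
proof (induction rule: dec_induct)
  case (step m)
  have "scale m i \<le> scale n i"
    using step by (intro scale_antimono) simp
  then show ?case
    using step assms(1) by (auto simp: path_Suc_nth alive_def coord_map_def simp del: path.simps)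
qed simp

lemma path_alive:
  assumes "alive p n i" "n \<le> m"
  shows "0 \<le> path p m $ i \<and> path p m $ i < scale n i"
  using assms(2)
proof (induction rule: dec_induct)
  case base
  then show ?case
    using assms by (simp add: alive_def)
next
  case (step m)
  then show ?case
    unfolding path_Suc_nth
    by (subst coord_map_less_iff[OF u_pos u_less_1]) (simp_all add: scale_antimono)
qed

lemma path_always_alive:
  assumes "\<And>n. alive p n i"
  shows "path p n $ i = scale n i * snd p $ i"
proof (induction n)
  case (Suc n)
  have n: "0 \<le> path p n $ i" "path p n $ i < scale n i"
    using assms[of n] by (auto simp: alive_def)
  have "path p (Suc n) $ i < u (Suc n) $ i * scale n i"
    using assms[of "Suc n"] by (simp add: alive_def scale_Suc del: path.simps)
  \<comment> \<open>Staying in the next cell at 0 forces the bit \<open>False\<close>, so the step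
    is multiplication by \<open>u (Suc n) $ i\<close>.\<close>
  then have "\<not> fst p (Suc n) $ i"
    unfolding path_Suc_nth using coord_map_bounds(3)[OF u_pos u_less_1 n] by simp
  then show ?case
    using n Suc scale_pos[of n i] by (simp add: path_Suc_nth coord_map_def branch_def scale_Suc del: path.simps)
qed simp

text \<open>A coordinate is either frozen from some time on, or it is the starting coordinate times
  \<open>scale n i\<close>, which decreases to some limit, possibly positive. Thus convergence holds
  for every path.\<close>

lemma path_convergent: "convergent (\<lambda>n. path p n $ i)"
proof (cases "\<forall>n. alive p n i")
  case True
  have "convergent (\<lambda>n. scale n i)"
    using scale_pos scale_antimono
    by (intro Bseq_monoseq_convergent decseq_imp_monoseq BseqI'[of _ 1]) (auto simp: decseq_def scale_le_1 less_imp_le)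
  then have "convergent (\<lambda>n. scale n i * snd p $ i)"
    by (intro convergent_mult convergent_const)
  then show ?thesis
    using True by (simp add: path_always_alive)
next
  case False
  then obtain n where "\<not> alive p n i"
    by blast
  then have "\<forall>\<^sub>F m in sequentially. path p m $ i = path p n $ i"
    unfolding eventually_sequentially using path_not_alive by blast
  then show ?thesis
    unfolding convergent_def by (intro exI tendsto_eventually)
qed

definition path_limit :: "(nat \<Rightarrow> 'r vertex) \<times> (real ^ 'r) \<Rightarrow> real ^ 'r"
  where "path_limit p = (\<chi> i. lim (\<lambda>n. path p n $ i))"

lemma path_tendsto: "(\<lambda>n. path p n) \<longlonglongrightarrow> path_limit p"
  by (rule vec_tendstoI) (use path_convergent in \<open>simp add: path_limit_def convergent_LIMSEQ_iff\<close>)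

lemma path_limit_not_alive:
  assumes "\<not> alive p n i"
  shows "path_limit p $ i = path p n $ i"
proof (rule LIMSEQ_unique)
  show "(\<lambda>n. path p n $ i) \<longlonglongrightarrow> path_limit p $ i"
    by (intro tendsto_vec_nth path_tendsto)
  have "\<forall>\<^sub>F m in sequentially. path p m $ i = path p n $ i"
    unfolding eventually_sequentially using path_not_alive[OF assms] by blast
  then show "(\<lambda>n. path p n $ i) \<longlonglongrightarrow> path p n $ i"
    by (rule tendsto_eventually)
qed

lemma path_limit_alive:
  assumes "alive p n i"
  shows "0 \<le> path_limit p $ i \<and> path_limit p $ i \<le> scale n i"
proof -
  have lim: "(\<lambda>n. path p n $ i) \<longlonglongrightarrow> path_limit p $ i"
    by (intro tendsto_vec_nth path_tendsto)
  show ?thesis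
  proof
    show "0 \<le> path_limit p $ i"
      using path_alive[OF assms] by (intro LIMSEQ_le_const[OF lim]) auto
    show "path_limit p $ i \<le> scale n i"
      using path_alive[OF assms] by (intro LIMSEQ_le_const2[OF lim]) (auto intro: less_imp_le)
  qed
qed

lemma path_limit_measurable [measurable]: "path_limit \<in> paths \<rightarrow>\<^sub>M borel"
  by (rule borel_measurable_LIMSEQ_metric[OF path_measurable path_tendsto])

section \<open>The law of the limit point and its order\<close>

definition limit :: "(real ^ 'r) measure"
  where "limit = distr paths borel path_limit"

sublocale limit: prob_space limit
  unfolding limit_def by (rule prob_space.prob_space_distr[OF prob_space_paths path_limit_measurable])

lemma sets_limit [simp, measurable_cong]: "sets limit = sets borel"
  by (simp add: limit_def)

text \<open>Dominated convergence on the path space. Convergence of \<open>f\<close> is required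
  along paths instead of continuity, so that it also covers functions cut off by an
  indicator.\<close>

lemma integral_stage_tendsto:
  fixes f :: "real ^ 'r \<Rightarrow> real"
  assumes [measurable]: "f \<in> borel_measurable borel" and "bounded (range f)"
    and lim: "\<And>p. (\<lambda>n. f (path p n)) \<longlonglongrightarrow> f (path_limit p)"
  shows "(\<lambda>n. \<integral>x. f x \<partial>stage n) \<longlonglongrightarrow> (\<integral>x. f x \<partial>limit)"
proof -
  interpret paths: prob_space paths
    by (rule prob_space_paths)
  obtain b where b: "\<And>x. \<bar>f x\<bar> \<le> b"
    using assms(2) by (auto simp: bounded_iff)
  have "(\<lambda>n. \<integral>p. f (path p n) \<partial>paths) \<longlonglongrightarrow> (\<integral>p. f (path_limit p) \<partial>paths)"
    by (rule integral_dominated_convergence[where w = "\<lambda>_. b"]) (use lim b in auto)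
  then show ?thesis
    unfolding stage_def limit_def by (simp add: integral_distr)
qed

lemma weak_limit_stage: "weak_limit stage limit"
  unfolding weak_limit_def
proof (intro conjI allI impI)
  fix f :: "real ^ 'r \<Rightarrow> real" assume f: "continuous_on UNIV f" "bounded (range f)"
  show "(\<lambda>n. \<integral>x. f x \<partial>stage n) \<longlonglongrightarrow> (\<integral>x. f x \<partial>limit)"
  proof (rule integral_stage_tendsto)
    show "(\<lambda>n. f (path p n)) \<longlonglongrightarrow> f (path_limit p)" for p
      by (rule continuous_on_tendsto_compose[OF f(1) path_tendsto]) auto
  qed (use f in \<open>auto intro: borel_measurable_continuous_onI\<close>)
qed (simp_all add: limit.finite_measure_axioms)

lemma tnest_lim_eq: "tnest_lim u z = limit"
  unfolding tnest_lim_def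
proof (rule the_equality)
  have "weak_limit (\<lambda>n. stage (Suc n)) limit"
    using weak_limit_stage unfolding weak_limit_def by (auto intro: LIMSEQ_Suc)
  then show "weak_limit (\<lambda>n. fst (tnest_iter u z n)) limit"
    by (simp add: tnest_iter_eq)
  then show "M = limit" if "weak_limit (\<lambda>n. fst (tnest_iter u z n)) M" for M
    using that weak_limit_unique by blast
qed

lemma AE_path_cube: "AE p in paths. path p n \<in> unit_cube"
proof -
  have "AE x in stage n. x \<in> unit_cube"
    using measure_stage_cube by (subst stage.AE_in_set_eq_1) auto
  then show ?thesis
    unfolding stage_def by (subst (asm) AE_distr_iff) auto
qed

text \<open>Countably many null sets are discarded at once, and the cube is closed.\<close>

lemma measure_limit_cube: "measure limit unit_cube = 1"
proof -
  have "AE p in paths. \<forall>n. path p n \<in> unit_cube"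
    by (simp add: AE_all_countable AE_path_cube)
  then have "AE p in paths. path_limit p \<in> unit_cube"
    by eventually_elim (rule closed_sequentially[OF closed_cbox _ path_tendsto], simp)
  then have "AE x in limit. x \<in> unit_cube"
    unfolding limit_def by (subst AE_distr_iff) auto
  then show ?thesis
    by (subst (asm) limit.AE_in_set_eq_1) auto
qed

text \<open>Composed with the projection, a bounded continuous test function is still bounded and
  continuous, and its integral is the same for all stages.\<close>

lemma push_along_limit:
  assumes \<nu>: "face_dim \<nu> = k"
  shows "push_along (compl_vertex \<nu>) limit = uniform_face \<nu>"
proof (rule finite_measure_eqI_continuous)
  show "finite_measure (push_along (compl_vertex \<nu>) limit)" "finite_measure (uniform_face \<nu>)"
    using prob_space_push_along[OF limit.prob_space_axioms sets_limit] uniform_face_prob_space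
    by (auto simp: prob_space_def)
  fix f :: "real ^ 'r \<Rightarrow> real" assume f: "continuous_on UNIV f" "bounded (range f)"
  let ?\<pi> = "proj_along (compl_vertex \<nu>)"
  have [measurable]: "f \<in> borel_measurable borel"
    using f(1) by (rule borel_measurable_continuous_onI)
  have "continuous_on UNIV (\<lambda>x :: real ^ 'r. if compl_vertex \<nu> $ i then 0 else x $ i)" for i
    by (cases "compl_vertex \<nu> $ i") (auto intro!: continuous_intros)
  then have "continuous_on UNIV ?\<pi>"
    unfolding proj_along_def[abs_def] by (intro continuous_on_vec_lambda)
  then have "continuous_on UNIV (f \<circ> ?\<pi>)"
    using f(1) continuous_on_subset by (intro continuous_on_compose) blast+
  moreover have "bounded (range (f \<circ> ?\<pi>))"
    using f(2) by (rule bounded_subset) auto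
  ultimately have "(\<lambda>n. \<integral>x. f (?\<pi> x) \<partial>stage n) \<longlonglongrightarrow> (\<integral>x. f (?\<pi> x) \<partial>limit)"
    using weak_limit_stage by (auto simp: weak_limit_def comp_def)
  moreover have "(\<integral>x. f (?\<pi> x) \<partial>stage n) = (\<integral>x. f x \<partial>uniform_face \<nu>)" for n
    unfolding push_along_stage[OF \<nu>, of n, symmetric] push_along_def
    by (subst integral_distr) auto
  ultimately have "(\<lambda>_. \<integral>x. f x \<partial>uniform_face \<nu>) \<longlonglongrightarrow> (\<integral>x. f (?\<pi> x) \<partial>limit)"
    by simp
  then have "(\<integral>x. f (?\<pi> x) \<partial>limit) = (\<integral>x. f x \<partial>uniform_face \<nu>)"
    using LIMSEQ_unique[OF tendsto_const] by metis
  then show "(\<integral>x. f x \<partial>push_along (compl_vertex \<nu>) limit) = (\<integral>x. f x \<partial>uniform_face \<nu>)"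
    unfolding push_along_def by (subst integral_distr) auto
qed simp_all

lemma copula_of_order_limit: "copula_of_order k limit"
  unfolding copula_of_order_def
  using limit.prob_space_axioms measure_limit_cube push_along_limit by simp

lemma measure_stage_corner:
  assumes z: "\<And>l. l \<ge> 1 \<Longrightarrow> z l = S_map (x l)"
  shows "measure (stage n) (rect (\<lambda>i. if \<nu> $ i then UNIV else {0..<scale n i})) = (\<Prod>l=1..n. x l \<nu>)"
proof (induction n)
  case 0
  have "measure unif01 UNIV = 1"
    using prob_space.prob_space[OF prob_space_unif01] by simp
  moreover have "{0..<1} \<inter> {0..1} = {0..<1::real}" "{0..1} \<inter> {0..<1} = {0..<1::real}"
    by auto
  ultimately have "measure unif01 (if \<nu> $ i then UNIV else {0..<scale 0 i}) = 1" for i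
    by (simp add: measure_unif01)
  then show ?case
    by (subst measure_stage_0_rect) simp_all
next
  case (Suc n)
  let ?B = "\<lambda>m i. if \<nu> $ i then UNIV else {0..<scale m i}"
  \<comment> \<open>The new corner is reached only from the old corner and only with bit
    \<open>False\<close>, so the vertex must vanish outside \<open>\<nu>\<close>.\<close>
  have pre: "coord_map (scale n i) (u (Suc n) $ i) b -` {0..<scale (Suc n) i} = (if b then {} else {0..<scale n i})" for i b
    unfolding scale_Suc using coord_map_less_scaled_iff[OF u_pos u_less_1 scale_pos] by auto
  have *: "measure (stage n) (rect (\<lambda>i. coord_map (scale n i) (u (Suc n) $ i) (\<mu> $ i) -` ?B (Suc n) i)) =
      of_bool (\<forall>i. \<mu> $ i \<longrightarrow> \<nu> $ i) * measure (stage n) (rect (?B n))" for \<mu>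
  proof (cases "\<forall>i. \<mu> $ i \<longrightarrow> \<nu> $ i")
    case True
    then have "(\<lambda>i. coord_map (scale n i) (u (Suc n) $ i) (\<mu> $ i) -` ?B (Suc n) i) = ?B n"
      by (auto simp: pre fun_eq_iff)
    then show ?thesis
      using True by simp
  next
    case False
    then obtain i where "\<mu> $ i" "\<not> \<nu> $ i"
      by blast
    then have "coord_map (scale n i) (u (Suc n) $ i) (\<mu> $ i) -` ?B (Suc n) i = {}"
      by (simp add: pre)
    then have "rect (\<lambda>i. coord_map (scale n i) (u (Suc n) $ i) (\<mu> $ i) -` ?B (Suc n) i) = {}"
      unfolding rect_def by blast
    then show ?thesis
      using False by simp
  qed
  have "measure (stage (Suc n)) (rect (?B (Suc n))) = (\<Sum>\<mu>\<in>UNIV. z (Suc n) \<mu> *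
      measure (stage n) (rect (\<lambda>i. coord_map (scale n i) (u (Suc n) $ i) (\<mu> $ i) -` ?B (Suc n) i)))"
    by (rule measure_stage_Suc_rect) simp
  also have "\<dots> = (\<Sum>\<mu>\<in>UNIV. z (Suc n) \<mu> * of_bool (\<forall>i. \<mu> $ i \<longrightarrow> \<nu> $ i)) * measure (stage n) (rect (?B n))"
    by (simp only: * sum_distrib_right mult.assoc)
  finally show ?case
    using Suc sum_S_map[of "x (Suc n)" \<nu>] by (simp add: z mult.commute)
qed

text \<open>The hyperplane meets each side of a grid box in at most one point. The lemma bridges
  closed corners for the limit and half-open ones for the stages.\<close>

lemma AE_path_neq_scale: "AE p in paths. path p n $ i \<noteq> scale n i"
proof -
  let ?B = "\<lambda>j. if j = i then {scale n i} else UNIV"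
  have "measure (stage n) (rect ?B) = 0"
  proof -
    have "measure unif01 (cell (lo J i) (hi J i) -` ?B i) = 0" if J: "J \<in> grid n" for J
    proof -
      have "{scale n i} \<inter> {lo J i..hi J i} = {} \<or> {scale n i} \<inter> {lo J i..hi J i} = {scale n i}"
        by blast
      then have "measure lborel ({scale n i} \<inter> {lo J i..hi J i}) = 0"
        by (elim disjE ssubst) (simp_all add: measure_def)
      then show ?thesis
        using grid_lo_hi(2)[OF J, of i] by (simp add: measure_cell_vimage grid_cell_def)
    qed
    then have zero: "(\<Prod>j\<in>UNIV. measure unif01 (cell (lo J j) (hi J j) -` ?B j)) = 0" if "J \<in> grid n" for J
      using that by (intro prod_zero bexI[of _ i]) auto
    have "measure (stage n) (rect ?B) =
        (\<Sum>J\<in>grid n. measure (stage n) J * (\<Prod>j\<in>UNIV. measure unif01 (cell (lo J j) (hi J j) -` ?B j)))"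
      by (rule measure_stage_rect) simp
    also have "\<dots> = 0"
      by (intro sum.neutral ballI) (simp only: zero mult_zero_right)
    finally show ?thesis .
  qed
  moreover have "rect ?B \<in> sets borel"
    by (intro rect_borel) auto
  ultimately have "AE x in stage n. x \<notin> rect ?B"
    by (subst AE_iff_measurable[where N = "rect ?B"]) (auto simp: stage.emeasure_eq_measure simp del: rect_iff)
  then have "AE p in paths. path p n \<notin> rect ?B"
    unfolding stage_def using \<open>rect ?B \<in> sets borel\<close> by (subst (asm) AE_distr_iff) auto
  then show ?thesis
    by eventually_elim (auto split: if_splits)
qed

text \<open>Along a path both events agree: a coordinate alive at time \<open>n\<close> satisfies
  both conditions, and a frozen one no longer changes and almost surely avoids the boundary
  value.\<close>

lemma measure_limit_corner:
  assumes "\<And>l. l \<ge> 1 \<Longrightarrow> z l = S_map (x l)"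
  shows "measure limit (rect (\<lambda>i. if \<nu> $ i then UNIV else {0..scale n i})) = (\<Prod>l=1..n. x l \<nu>)"
proof -
  interpret paths: prob_space paths
    by (rule prob_space_paths)
  let ?R = "rect (\<lambda>i. if \<nu> $ i then UNIV else {0..scale n i})"
  let ?Q = "rect (\<lambda>i. if \<nu> $ i then UNIV else {0..<scale n i})"
  have [measurable]: "?R \<in> sets borel" "?Q \<in> sets borel"
    by (auto intro!: rect_borel)
  have "AE p in paths. \<forall>i. path p n $ i \<noteq> scale n i"
    by (simp add: AE_all_countable AE_path_neq_scale)
  then have "AE p in paths. p \<in> path_limit -` ?R \<inter> space paths \<longleftrightarrow> p \<in> (\<lambda>p. path p n) -` ?Q \<inter> space paths"
  proof eventually_elim
    case (elim p)
    have "path_limit p $ i \<in> {0..scale n i} \<longleftrightarrow> path p n $ i \<in> {0..<scale n i}" for i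
    proof (cases "alive p n i")
      case True
      then show ?thesis
        using path_limit_alive[OF True] by (auto simp: alive_def)
    next
      case False
      then show ?thesis
        using path_limit_not_alive[OF False] elim by (auto simp: alive_def less_le)
    qed
    then show ?case
      by auto
  qed
  then have "measure limit ?R = measure (stage n) ?Q"
    unfolding limit_def stage_def by (simp add: measure_distr paths.finite_measure_eq_AE)
  then show ?thesis
    using measure_stage_corner[OF assms] by simp
qed

lemma measure_push_along_limit_corner:
  assumes "\<And>l. l \<ge> 1 \<Longrightarrow> z l = S_map (x l)"
  shows "measure (push_along \<nu> limit) (cbox 0 (tail_corner u n \<nu>)) = (\<Prod>l=1..n. x l \<nu>)"
proof -
  have "proj_along \<nu> -` cbox 0 (tail_corner u n \<nu>) = rect (\<lambda>i. if \<nu> $ i then UNIV else {0..scale n i})"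
    unfolding cbox_eq_rect proj_along_vimage_rect
    by (rule arg_cong[where f = rect]) (auto simp: tail_corner_def scale_def fun_eq_iff)
  then show ?thesis
    using measure_limit_corner[OF assms] by (simp add: measure_push_along)
qed

text \<open>From time \<open>N\<close> on, the coordinates outside \<open>Z\<close> are frozen on
  this region and the remaining ones number at most \<open>k\<close>, so the restrictions of all
  later stages coincide. The region is open and not closed, hence weak convergence alone is not
  enough and the paths are used again.\<close>

lemma measure_limit_eq_stage:
  assumes Z: "card Z \<le> k" and A: "A \<in> sets borel" "A \<subseteq> rect (\<lambda>i. if i \<in> Z then UNIV else {scale N i<..})"
  shows "measure limit A = measure (stage N) A"
proof -
  let ?R = "rect (\<lambda>i. if i \<in> Z then UNIV else {scale N i<..}) :: (real ^ 'r) set"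
  let ?D = "\<lambda>M. density M (\<lambda>x. ennreal (indicator ?R x))"
  have R [measurable]: "?R \<in> sets borel"
    by (auto intro!: rect_borel)
  have D: "emeasure (?D M) C = emeasure M (C \<inter> ?R)" if "sets M = sets borel" "C \<in> sets borel" for M C
  proof -
    note [measurable_cong] = that(1)
    show ?thesis
      using that by (subst emeasure_density) (auto simp: ennreal_indicator indicator_inter_arith[symmetric] Int_commute)
  qed
  have D_fin: "finite_measure (?D M)" if "finite_measure M" "sets M = sets borel" for M
    using that D[OF that(2), of UNIV] sets_eq_imp_space_eq[OF that(2)]
    by (intro finite_measureI) (simp add: finite_measure.emeasure_eq_measure del: rect_iff)
  have stages: "?D (stage n) = ?D (stage N)" if "N \<le> n" for n
    using that
  proof (induction rule: dec_induct)
    case (step n)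
    have "?D (stage (Suc n)) = ?D (stage n)"
    proof (rule measure_eqI_rect)
      fix B :: "'r \<Rightarrow> real set" assume B: "\<And>i. B i \<in> sets borel"
      let ?B = "\<lambda>i. B i \<inter> (if i \<in> Z then UNIV else {scale N i<..})"
      have "measure (stage (Suc n)) (rect ?B) = measure (stage n) (rect ?B)"
      proof (rule measure_stage_Suc_rect_eq[OF Z])
        fix i b assume i: "i \<notin> Z"
        have le: "scale n i \<le> scale N i"
          using step by (intro scale_antimono) simp
        show "coord_map (scale n i) (u (Suc n) $ i) b -` ?B i = ?B i"
        proof (intro set_eqI)
          fix w
          show "w \<in> coord_map (scale n i) (u (Suc n) $ i) b -` ?B i \<longleftrightarrow> w \<in> ?B i"
            using i le coord_map_greater_iff[OF u_pos u_less_1 _ le, where b = b and w = w] scale_pos[of n i]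
            by (cases "scale N i < w") (auto simp: coord_map_eq_self)
        qed
      qed (use B in auto)
      then show "measure (?D (stage (Suc n))) (rect B) = measure (?D (stage n)) (rect B)"
        using B by (simp add: measure_def D rect_Int)
    qed (auto intro!: D_fin stage.finite_measure_axioms)
    with step show ?case
      by simp
  qed simp
  have "?D limit = ?D (stage N)"
  proof (rule finite_measure_eqI_continuous)
    fix f :: "real ^ 'r \<Rightarrow> real" assume f: "continuous_on UNIV f" "bounded (range f)"
    have [measurable]: "f \<in> borel_measurable borel"
      using f(1) by (rule borel_measurable_continuous_onI)
    have "(\<lambda>n. \<integral>x. indicator ?R x *\<^sub>R f x \<partial>stage n) \<longlonglongrightarrow> (\<integral>x. indicator ?R x *\<^sub>R f x \<partial>limit)"
    proof (rule integral_stage_tendsto)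
      obtain b where "\<And>x. \<bar>f x\<bar> \<le> b"
        using f(2) by (auto simp: bounded_iff)
      then have "norm (indicator ?R x *\<^sub>R f x) \<le> b" for x
        using order_trans[OF abs_ge_zero] by (auto simp: indicator_def)
      then show "bounded (range (\<lambda>x. indicator ?R x *\<^sub>R f x))"
        by (auto simp: bounded_iff)
      fix p
      \<comment> \<open>A coordinate alive at time \<open>N\<close> stays at most
        \<open>scale N i\<close>, even in the limit; the strict inequality defining the region
        excludes it throughout. So membership is constant along a path from \<open>N\<close>
        on.\<close>
      have R_iff: "path p n \<in> ?R \<longleftrightarrow> path_limit p \<in> ?R" if "n \<ge> N" for n
      proof -
        have "scale N i < path p n $ i \<longleftrightarrow> scale N i < path_limit p $ i" for i
        proof (cases "alive p N i")
          case True
          then show ?thesis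
            using path_limit_alive[OF True] path_alive[OF True that] by auto
        next
          case False
          then show ?thesis
            using path_limit_not_alive[OF False] path_not_alive[OF False that] by simp
        qed
        then show ?thesis
          by auto
      qed
      have "(\<lambda>n. f (path p n)) \<longlonglongrightarrow> f (path_limit p)"
        by (rule continuous_on_tendsto_compose[OF f(1) path_tendsto]) auto
      then have "(\<lambda>n. indicator ?R (path_limit p) *\<^sub>R f (path p n)) \<longlonglongrightarrow> indicator ?R (path_limit p) *\<^sub>R f (path_limit p)"
        by (intro tendsto_intros)
      moreover have "\<forall>\<^sub>F n in sequentially. indicator ?R (path p n) *\<^sub>R f (path p n) = indicator ?R (path_limit p) *\<^sub>R f (path p n)"
        using R_iff by (auto simp: eventually_sequentially indicator_def simp del: rect_iff)
      ultimately show "(\<lambda>n. indicator ?R (path p n) *\<^sub>R f (path p n)) \<longlonglongrightarrow> indicator ?R (path_limit p) *\<^sub>R f (path_limit p)"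
        by (simp only: tendsto_cong)
    qed simp
    moreover have "(\<integral>x. indicator ?R x *\<^sub>R f x \<partial>M) = (\<integral>x. f x \<partial>?D M)" if "sets M = sets borel" for M
    proof -
      note [measurable_cong] = that
      show ?thesis
        by (subst integral_density) auto
    qed
    ultimately have "(\<lambda>n. \<integral>x. f x \<partial>?D (stage n)) \<longlonglongrightarrow> (\<integral>x. f x \<partial>?D limit)"
      by simp
    moreover have "(\<lambda>n. \<integral>x. f x \<partial>?D (stage n)) \<longlonglongrightarrow> (\<integral>x. f x \<partial>?D (stage N))"
    proof (rule tendsto_eventually)
      have "(\<integral>x. f x \<partial>?D (stage n)) = (\<integral>x. f x \<partial>?D (stage N))" if "N \<le> n" for n
        by (simp only: stages[OF that])
      then show "\<forall>\<^sub>F n in sequentially. (\<integral>x. f x \<partial>?D (stage n)) = (\<integral>x. f x \<partial>?D (stage N))"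
        unfolding eventually_sequentially by blast
    qed
    ultimately show "(\<integral>x. f x \<partial>?D limit) = (\<integral>x. f x \<partial>?D (stage N))"
      by (rule LIMSEQ_unique)
  qed (auto intro!: D_fin stage.finite_measure_axioms limit.finite_measure_axioms)
  then have "emeasure limit (A \<inter> ?R) = emeasure (stage N) (A \<inter> ?R)"
    using A(1) D[of limit A] D[of "stage N" A] by simp
  moreover have "A \<inter> ?R = A"
    using A(2) by blast
  ultimately show ?thesis
    by (simp add: measure_def)
qed

lemma box_measure_stage: "box_measure (measure (stage n))"
  unfolding box_measure_def
proof (rule conjI[OF _ exI[of _ "grid n"]], goal_cases)
  case 1
  show "signed_measure_on_cube (measure (stage n))"
    unfolding signed_measure_on_cube_def
  proof (intro conjI allI impI)
    fix A :: "nat \<Rightarrow> (real ^ 'r) set"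
    assume "\<forall>j. A j \<in> sets borel \<and> A j \<subseteq> unit_cube" "disjoint_family A"
    then show "(\<lambda>j. measure (stage n) (A j)) sums measure (stage n) (\<Union>j. A j)"
      by (intro stage.finite_measure_UNION) auto
  qed simp
next
  case 2
  have "interior J \<noteq> {} \<and> (\<exists>c. \<forall>A\<in>sets borel. A \<subseteq> J \<longrightarrow> measure (stage n) A = c * measure lborel A)"
    if "J \<in> grid n" for J
  proof -
    from that obtain a b where ab: "J = cbox a b" "\<And>i. grid_cell (scale n i) (a $ i) (b $ i)" "uniform_on (stage n) J"
      using grid_uniform_cell by blast
    have "box a b \<noteq> {}"
      using ab(2) by (auto simp: interval_ne_empty_cart grid_cell_def)
    then show ?thesis
      using ab(1,3) by (simp add: uniform_on_def)
  qed
  then show ?case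
    by (intro conjI ballI grid_division) simp_all
qed

text \<open>The coordinates of \<open>w\<close> that vanish are the only ones that no scale drops
  below. Avoiding the faces of codimension above \<open>k\<close> bounds their number by
  \<open>k\<close>.\<close>

lemma locally_piecewise_uniform_on_limit:
  assumes "(\<lambda>n. tail_corner u n (\<chi> i. False)) \<longlonglongrightarrow> 0"
  shows "locally_piecewise_uniform_on limit (unit_cube - \<Union> (faces_codim_gt k))"
  unfolding locally_piecewise_uniform_on_def
proof
  fix w :: "real ^ 'r" assume w: "w \<in> unit_cube - \<Union> (faces_codim_gt k)"
  define Z where "Z = {i. w $ i = 0}"
  have "w \<in> front_face (\<chi> i. i \<notin> Z)"
    using w by (simp add: front_face_def Z_def)
  then have "\<not> face_codim (\<chi> i. i \<notin> Z) > k"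
    using w by (auto simp: faces_codim_gt_def)
  moreover have "face_dim (\<chi> i. i \<notin> Z) = CARD('r) - card Z"
    by (simp add: face_dim_def Compl_eq[symmetric] Compl_eq_Diff_UNIV card_Diff_subset)
  moreover have "card Z \<le> CARD('r)"
    by (simp add: card_mono)
  ultimately have Z: "card Z \<le> k"
    by (simp add: face_codim_def)
  have scale0: "(\<lambda>n. scale n i) \<longlonglongrightarrow> 0" for i
    using tendsto_vec_nth[OF assms, of i] by (simp add: tail_corner_def scale_def)
  have pos: "0 < w $ i" if "i \<notin> Z" for i
    using w that by (auto simp: Z_def mem_box_cart less_le)
  \<comment> \<open>Finitely many positive coordinates and scales tending to 0 admit a common stage
    \<open>N\<close>, which yields the neighbourhood and the box measure.\<close>
  have "\<forall>\<^sub>F n in sequentially. \<forall>i. i \<notin> Z \<longrightarrow> scale n i < w $ i"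
  proof (rule eventually_all_finite)
    fix i
    show "\<forall>\<^sub>F n in sequentially. i \<notin> Z \<longrightarrow> scale n i < w $ i"
      using order_tendstoD(2)[OF scale0 pos] by (cases "i \<in> Z") auto
  qed
  then obtain N where N: "\<And>i. i \<notin> Z \<Longrightarrow> scale N i < w $ i"
    by (auto simp: eventually_sequentially)
  let ?R = "rect (\<lambda>i. if i \<in> Z then UNIV else {scale N i<..}) :: (real ^ 'r) set"
  have "open ?R"
  proof -
    have "?R = (\<Inter>i\<in>-Z. {p. scale N i < p $ i})"
      by (auto split: if_splits)
    then show ?thesis
      by (auto intro!: open_INT open_halfspace_component_gt_cart)
  qed
  show "\<exists>W m. openin (top_of_set unit_cube) W \<and> w \<in> W \<and> box_measure m \<and>
      (\<forall>A\<in>sets borel. A \<subseteq> W \<longrightarrow> measure limit A = m A)"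
  proof (intro exI conjI ballI impI)
    show "openin (top_of_set unit_cube) (unit_cube \<inter> ?R)"
      using \<open>open ?R\<close> by (rule openin_open_Int)
    show "w \<in> unit_cube \<inter> ?R"
      using w N by auto
    show "box_measure (measure (stage N))"
      by (rule box_measure_stage)
    show "measure limit A = measure (stage N) A" if "A \<in> sets borel" "A \<subseteq> unit_cube \<inter> ?R" for A
      using that by (intro measure_limit_eq_stage[OF Z]) auto
  qed
qed

end

theorem theorem6p5:
  fixes k :: nat
    and u :: "nat \<Rightarrow> real ^ 'r::finite"
    and x :: "nat \<Rightarrow> 'r vertex \<Rightarrow> real"
  assumes "k \<le> CARD('r)"
    and "\<And>n. n \<ge> 1 \<Longrightarrow> u n \<in> box 0 1"
    and "\<And>n. n \<ge> 1 \<Longrightarrow> S_map (x n) \<in> vertex_copulas k (u n)"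
  defines "c_inf \<equiv> tnest_lim u (\<lambda>n. S_map (x n))"
  shows "copula_of_order k c_inf \<and>
    (\<forall>n\<ge>1. \<forall>\<nu>. measure (push_along \<nu> c_inf) (cbox 0 (tail_corner u n \<nu>)) =
        (\<Prod>l=1..n. x l \<nu>)) \<and>
    ((\<lambda>n. tail_corner u n (\<chi> i. False)) \<longlonglongrightarrow> 0 \<longrightarrow>
      locally_piecewise_uniform_on c_inf (unit_cube - \<Union> (faces_codim_gt k)))"
proof -
  interpret tail_nesting k u "\<lambda>n. S_map (x n)"
    using assms(1-3) by unfold_locales
  show ?thesis
    unfolding c_inf_def tnest_lim_eq
    using copula_of_order_limit measure_push_along_limit_corner[of x] locally_piecewise_uniform_on_limit
    by blast
qed

end
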